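(* Let $n\ge1$ and let $\bar\alpha$ be a smooth real function on an interval $I$ such that, for some antiderivative $\int\bar\alpha\,ds$, $$\frac{1}{\left(e^{\int\bar\alpha\,ds}\right)^2}-\bar\alpha^2\ \ge\ 0\quad\text{on } I.$$ Let $\bar k$ be a smooth function on $I$ with $$\bar k^2=\frac{1}{\left(e^{\int\bar\alpha\,ds}\right)^2}-\bar\alpha^2 .$$ Then there exists a rotationally symmetric hypersurface in $H_n$, generated by a curve parametrized by $s\in I$, such that $\alpha(s)=\bar\alpha(s)$ and $k(s)=\bar k(s)$ for all $s$, and $s$ is the horizontal arc-length. In addition, such a hypersurface is determined up to a Heisenberg rigid motion.
   Context: The Heisenberg group $H_n$ is $\mathbb R^{2n+1}$ with coordinates $(x_1,\dots,x_n,y_1,\dots,y_n,t)$, $z=(x_1+iy_1,\dots,x_n+iy_n)$, group law $(x,y,t)\circ(x',y',t')=(x+x',y+y',t+t'+\sum_j(y_jx_j'-x_jy_j'))$, contact form $\Theta=dt+\sum_{j}(x_jdy_j-y_jdx_j)$, contact bundle $\xi=\ker\Theta$, and left-invariant fields $\mathring e_\beta=\partial_{x_\beta}+y_\beta\partial_t$, $\mathring e_{n+\beta}=\partial_{y_\beta}-x_\beta\partial_t$, $T=\partial_t$. $J\mathring e_\beta=\mathring e_{n+\beta}$, $J\mathring e_{n+\beta}=-\mathring e_\beta$; the Levi metric $G$ on $\xi$ makes $\mathring e_1,\dots,\mathring e_{2n}$ orthonormal; $\nabla$ is the flat connection for which all $\mathring e_a$ and $T$ are parallel. Heisenberg rigid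 motions are the elements of $PSH(n)$, generated by left translations and the maps $(z,t)\mapsto(Az,t)$, $A\in U(n)$. A rotationally symmetric hypersurface is one invariant under $U(n)$, generated by a smooth regular curve $(x(s),t(s))$, $x>0$, in the $x_nt$-plane: $\Sigma=\{(z,t):(|z|,t)=(x(s),t(s))\text{ for some }s\}$. The horizontal generating curve is $\tilde\gamma(s)=(0,\dots,0,x\cos\theta(s),0,\dots,0,x\sin\theta(s),t(s))$ with $\theta'=-t'/x^2$, so $\tilde\gamma'\in\xi$. The parameter $s$ is the horizontal arc-length if $|\tilde\gamma'|_G=1$, i.e. $(x')^2+(t')^2/x^2=1$. Invariants. Let $\xi'=(\xi\cap T\Sigma)\cap J(\xi\cap T\Sigma)$, let $e_n\in\xi\cap T\Sigma$ be the unit vector $G$-orthogonal to $\xi'$ with orientation given by $\tilde\gamma'$, and $e_{2n}=Je_n$. Define $\alpha$ by $\alpha e_{2n}+T\in T\Sigma$. For $n\ge2$, $k$ is the common eigenvalue on $\xi'$ of $v\mapsto-\nabla_ve_{2n}+\alpha Jv$ (it exists for rotationally symmetric hypersurfaces); for $n=1$, $k$ is defined by the formula valid for $n\ge2$, $k=\frac{-t'}{x\sqrt{(xx')^2+(t')^2}}$. By symmetry $\alpha,k$ are functions of $s$. *)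

theory Defs
  imports "HOL-Analysis.Analysis"
begin

section \<open>Smooth functions on an interval\<close>

text \<open>Intervals may contain their endpoints, so all derivatives are taken within the interval.
  The witness \<open>D\<close> is the sequence of iterated derivatives.\<close>

definition smooth_on :: "real set \<Rightarrow> (real \<Rightarrow> real) \<Rightarrow> bool" where
  "smooth_on I f \<longleftrightarrow> (\<exists>D :: nat \<Rightarrow> real \<Rightarrow> real.
     (\<forall>s\<in>I. D 0 s = f s) \<and>
     (\<forall>i. \<forall>s\<in>I. (D i has_real_derivative D (Suc i) s) (at s within I)))"

section \<open>The Heisenberg group\<close>

text \<open>A point \<open>(x, y, t)\<close> of \<open>H_n\<close> is the pair \<open>(z, t)\<close> with \<open>z = x + i y\<close>, and \<open>n = CARD('n)\<close>.
  Tangent vectors are elements of the same type, with components taken with respect to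
  the coordinate fields: \<open>(\<zeta>, \<tau>)\<close> stands for
  \<open>\<Sum>j. Re \<zeta>_j \<partial>/\<partial>x_j + Im \<zeta>_j \<partial>/\<partial>y_j\<close> plus \<open>\<tau> \<partial>/\<partial>t\<close>.\<close>

type_synonym 'n heis = "(complex, 'n) vec \<times> real"

definition heis_mult :: "'n::finite heis \<Rightarrow> 'n heis \<Rightarrow> 'n heis" where
  "heis_mult p q = (fst p + fst q,
     snd p + snd q + (\<Sum>j\<in>UNIV. Im (fst p $ j) * Re (fst q $ j) - Re (fst p $ j) * Im (fst q $ j)))"

definition contact_form :: "'n::finite heis \<Rightarrow> 'n heis \<Rightarrow> real" where
  "contact_form p v =
     snd v + (\<Sum>j\<in>UNIV. Re (fst p $ j) * Im (fst v $ j) - Im (fst p $ j) * Re (fst v $ j))"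

definition contact_bundle :: "'n::finite heis \<Rightarrow> 'n heis set" where
  "contact_bundle p = {v. contact_form p v = 0}"

definition frame_x :: "'n::finite \<Rightarrow> 'n heis \<Rightarrow> 'n heis" where
  "frame_x j p = (axis j 1, Im (fst p $ j))"

definition frame_y :: "'n::finite \<Rightarrow> 'n heis \<Rightarrow> 'n heis" where
  "frame_y j p = (axis j \<i>, - Re (fst p $ j))"

definition reeb :: "'n::finite heis" where
  "reeb = (0, 1)"

text \<open>Passage between a tangent vector at \<open>p\<close> and its coefficients with respect to the
  left-invariant frame; the coefficients \<open>a_j\<close> of \<open>frame_x j\<close> and \<open>b_j\<close> of \<open>frame_y j\<close>
  are stored as the complex number \<open>a_j + i b_j\<close>.\<close>

definition of_coeffs :: "'n::finite heis \<Rightarrow> 'n heis \<Rightarrow> 'n heis" where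
  "of_coeffs p c =
     (\<Sum>j\<in>UNIV. Re (fst c $ j) *\<^sub>R frame_x j p + Im (fst c $ j) *\<^sub>R frame_y j p) + snd c *\<^sub>R reeb"

definition coeffs :: "'n::finite heis \<Rightarrow> 'n heis \<Rightarrow> 'n heis" where
  "coeffs p v = (fst v, contact_form p v)"

lemma fst_of_coeffs: "fst (of_coeffs p c) = fst c"
proof -
  have "Re (fst c $ j) *\<^sub>R axis j 1 + Im (fst c $ j) *\<^sub>R axis j \<i> = axis j (fst c $ j)" for j
    by (auto simp: vec_eq_iff axis_def complex_eq_iff)
  moreover have "(\<Sum>j\<in>UNIV. axis j (fst c $ j)) = fst c"
    by (simp add: vec_eq_iff axis_def)
  ultimately show ?thesis
    by (simp add: of_coeffs_def frame_x_def frame_y_def reeb_def fst_sum)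
qed

lemma snd_of_coeffs: "snd (of_coeffs p c) =
   (\<Sum>j\<in>UNIV. Re (fst c $ j) * Im (fst p $ j) - Im (fst c $ j) * Re (fst p $ j)) + snd c"
  by (simp add: of_coeffs_def frame_x_def frame_y_def reeb_def snd_sum)

lemma of_coeffs_coeffs: "of_coeffs p (coeffs p v) = v"
  by (rule prod_eqI)
     (simp_all add: fst_of_coeffs snd_of_coeffs coeffs_def contact_form_def sum_subtractf mult.commute)

lemma coeffs_of_coeffs: "coeffs p (of_coeffs p c) = c"
  by (rule prod_eqI)
     (simp_all add: fst_of_coeffs snd_of_coeffs coeffs_def contact_form_def sum_subtractf mult.commute)

text \<open>\<open>J\<close> and the Levi metric are meant for vectors of the contact bundle; the \<open>T\<close>-component
  of the argument is ignored.\<close>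

definition J :: "'n::finite heis \<Rightarrow> 'n heis \<Rightarrow> 'n heis" where
  "J p v = (\<Sum>j\<in>UNIV. Re (fst (coeffs p v) $ j) *\<^sub>R frame_y j p - Im (fst (coeffs p v) $ j) *\<^sub>R frame_x j p)"

definition levi :: "'n::finite heis \<Rightarrow> 'n heis \<Rightarrow> 'n heis \<Rightarrow> real" where
  "levi p v w = (\<Sum>j\<in>UNIV. Re (fst (coeffs p v) $ j) * Re (fst (coeffs p w) $ j)
                       + Im (fst (coeffs p v) $ j) * Im (fst (coeffs p w) $ j))"

definition unitary :: "complex^'n^'n::finite \<Rightarrow> bool" where
  "unitary A \<longleftrightarrow> A ** (\<chi> i j. cnj (A $ j $ i)) = mat 1"

definition rot :: "complex^'n^'n::finite \<Rightarrow> 'n heis \<Rightarrow> 'n heis" where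
  "rot A p = (A *v fst p, snd p)"

text \<open>The group generated by left translations and unitary rotations.\<close>

inductive_set PSH :: "('n::finite heis \<Rightarrow> 'n heis) set" where
  translation: "heis_mult p \<in> PSH"
| rotation: "unitary A \<Longrightarrow> rot A \<in> PSH"
| composition: "f \<in> PSH \<Longrightarrow> g \<in> PSH \<Longrightarrow> f \<circ> g \<in> PSH"
| inverse: "f \<in> PSH \<Longrightarrow> inv f \<in> PSH"

section \<open>Rotationally symmetric hypersurfaces\<close>

definition generating_curve :: "real set \<Rightarrow> (real \<Rightarrow> real) \<Rightarrow> (real \<Rightarrow> real) \<Rightarrow> bool" where
  "generating_curve I x t \<longleftrightarrow> smooth_on I x \<and> smooth_on I t \<and>
     (\<forall>s\<in>I. 0 < x s \<and> (vector_derivative x (at s within I), vector_derivative t (at s within I)) \<noteq> (0, 0))"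

definition rot_sym_hypersurface ::
  "real set \<Rightarrow> (real \<Rightarrow> real) \<Rightarrow> (real \<Rightarrow> real) \<Rightarrow> 'n::finite heis set \<Rightarrow> bool" where
  "rot_sym_hypersurface I x t S \<longleftrightarrow> generating_curve I x t \<and>
     S = {(z, \<tau>). \<exists>s\<in>I. (norm z, \<tau>) = (x s, t s)} \<and>
     (\<forall>A. unitary A \<longrightarrow> rot A ` S = S)"

text \<open>The generating curve may cross itself, so the hypersurface is treated as immersed: its points
  are addressed by a parameter \<open>s\<close> and a direction \<open>\<omega> \<noteq> 0\<close>, and the tangent space at a
  parameter is the image of the differential of \<open>immersion\<close>. The latter depends on \<open>\<omega>\<close> only
  through \<open>\<omega> / |\<omega>|\<close>; letting \<open>\<omega>\<close> range over nonzero vectors rather than over the unit sphere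
  makes Frechet derivatives within \<open>param_domain\<close> unique.\<close>

definition immersion :: "(real \<Rightarrow> real) \<Rightarrow> (real \<Rightarrow> real) \<Rightarrow> real \<times> (complex^'n::finite) \<Rightarrow> 'n heis" where
  "immersion x t q = (x (fst q) *\<^sub>R sgn (snd q), t (fst q))"

definition param_domain :: "real set \<Rightarrow> (real \<times> (complex^'n::finite)) set" where
  "param_domain I = I \<times> (- {0})"

definition tangent_space ::
  "real set \<Rightarrow> (real \<Rightarrow> real) \<Rightarrow> (real \<Rightarrow> real) \<Rightarrow> real \<times> (complex^'n::finite) \<Rightarrow> 'n heis set" where
  "tangent_space I x t q =
     {v. \<exists>D. (immersion x t has_derivative D) (at q within param_domain I) \<and> v \<in> range D}"

definition contact_tangent ::
  "real set \<Rightarrow> (real \<Rightarrow> real) \<Rightarrow> (real \<Rightarrow> real) \<Rightarrow> real \<times> (complex^'n::finite) \<Rightarrow> 'n heis set" where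
  "contact_tangent I x t q = contact_bundle (immersion x t q) \<inter> tangent_space I x t q"

definition xi' ::
  "real set \<Rightarrow> (real \<Rightarrow> real) \<Rightarrow> (real \<Rightarrow> real) \<Rightarrow> real \<times> (complex^'n::finite) \<Rightarrow> 'n heis set" where
  "xi' I x t q = contact_tangent I x t q \<inter> J (immersion x t q) ` contact_tangent I x t q"

section \<open>The horizontal generating curve\<close>

definition horizontal_angle :: "real set \<Rightarrow> (real \<Rightarrow> real) \<Rightarrow> (real \<Rightarrow> real) \<Rightarrow> (real \<Rightarrow> real) \<Rightarrow> bool" where
  "horizontal_angle I x t \<theta> \<longleftrightarrow>
     (\<forall>s\<in>I. (\<theta> has_real_derivative - vector_derivative t (at s within I) / (x s)\<^sup>2) (at s within I))"

text \<open>The index \<open>m\<close> plays the role of the last coordinate \<open>n\<close>; the index type carries no order.\<close>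

definition horizontal_curve ::
  "'n::finite \<Rightarrow> (real \<Rightarrow> real) \<Rightarrow> (real \<Rightarrow> real) \<Rightarrow> (real \<Rightarrow> real) \<Rightarrow> real \<Rightarrow> 'n heis" where
  "horizontal_curve m x t \<theta> s = (axis m (Complex (x s * cos (\<theta> s)) (x s * sin (\<theta> s))), t s)"

definition horizontal_arclength ::
  "real set \<Rightarrow> 'n::finite \<Rightarrow> (real \<Rightarrow> real) \<Rightarrow> (real \<Rightarrow> real) \<Rightarrow> bool" where
  "horizontal_arclength I m x t \<longleftrightarrow> (\<exists>\<theta>. horizontal_angle I x t \<theta> \<and>
     (\<forall>s\<in>I. let \<gamma> = horizontal_curve m x t \<theta>; \<gamma>' = vector_derivative \<gamma> (at s within I)
            in sqrt (levi (\<gamma> s) \<gamma>' \<gamma>') = 1))"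

section \<open>The invariants\<close>

text \<open>The orientation of \<open>e_n\<close> at a point off the horizontal generating curve is given by the
  rotated copies of that curve passing through the point.\<close>

definition e_n ::
  "real set \<Rightarrow> 'n::finite \<Rightarrow> (real \<Rightarrow> real) \<Rightarrow> (real \<Rightarrow> real) \<Rightarrow> real \<times> (complex^'n) \<Rightarrow> 'n heis" where
  "e_n I m x t q = (let p = immersion x t q in
     THE e. e \<in> contact_tangent I x t q \<and> levi p e e = 1 \<and> (\<forall>v\<in>xi' I x t q. levi p e v = 0) \<and>
       (\<exists>\<theta> A. horizontal_angle I x t \<theta> \<and> unitary A \<and> rot A (horizontal_curve m x t \<theta> (fst q)) = p \<and>
          levi p e (vector_derivative (\<lambda>\<sigma>. rot A (horizontal_curve m x t \<theta> \<sigma>)) (at (fst q) within I)) > 0))"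

definition e_2n ::
  "real set \<Rightarrow> 'n::finite \<Rightarrow> (real \<Rightarrow> real) \<Rightarrow> (real \<Rightarrow> real) \<Rightarrow> real \<times> (complex^'n) \<Rightarrow> 'n heis" where
  "e_2n I m x t q = J (immersion x t q) (e_n I m x t q)"

definition alpha ::
  "real set \<Rightarrow> 'n::finite \<Rightarrow> (real \<Rightarrow> real) \<Rightarrow> (real \<Rightarrow> real) \<Rightarrow> real \<times> (complex^'n) \<Rightarrow> real" where
  "alpha I m x t q = (THE a. a *\<^sub>R e_2n I m x t q + reeb \<in> tangent_space I x t q)"

text \<open>\<open>has_nabla I x t V q v w\<close> says \<open>w = \<nabla>_v V\<close>, for a field \<open>V\<close> along the immersion and a tangent
  vector \<open>v\<close> of the hypersurface at the parameter \<open>q\<close>. Since the left-invariant frame is parallel,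
  one differentiates the frame coefficients of \<open>V\<close> in a direction \<open>u\<close> of the parameter domain
  that is mapped to \<open>v\<close>.\<close>

definition has_nabla ::
  "real set \<Rightarrow> (real \<Rightarrow> real) \<Rightarrow> (real \<Rightarrow> real) \<Rightarrow> (real \<times> (complex^'n::finite) \<Rightarrow> 'n heis) \<Rightarrow>
   real \<times> (complex^'n) \<Rightarrow> 'n heis \<Rightarrow> 'n heis \<Rightarrow> bool" where
  "has_nabla I x t V q v w \<longleftrightarrow> (\<exists>D E u.
     (immersion x t has_derivative D) (at q within param_domain I) \<and> D u = v \<and>
     ((\<lambda>r. coeffs (immersion x t r) (V r)) has_derivative E) (at q within param_domain I) \<and>
     w = of_coeffs (immersion x t q) (E u))"

definition k_inv ::
  "real set \<Rightarrow> 'n::finite \<Rightarrow> (real \<Rightarrow> real) \<Rightarrow> (real \<Rightarrow> real) \<Rightarrow> real \<times> (complex^'n) \<Rightarrow> real" where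
  "k_inv I m x t q =
     (if CARD('n) \<ge> 2
      then THE \<kappa>. \<forall>v\<in>xi' I x t q. \<exists>w. has_nabla I x t (e_2n I m x t) q v w \<and>
             - w + alpha I m x t q *\<^sub>R J (immersion x t q) v = \<kappa> *\<^sub>R v
      else let s = fst q; x' = vector_derivative x (at s within I); t' = vector_derivative t (at s within I)
           in - t' / (x s * sqrt ((x s * x')\<^sup>2 + t'\<^sup>2)))"

definition realizes ::
  "real set \<Rightarrow> 'n::finite \<Rightarrow> (real \<Rightarrow> real) \<Rightarrow> (real \<Rightarrow> real) \<Rightarrow>
   (real \<Rightarrow> real) \<Rightarrow> (real \<Rightarrow> real) \<Rightarrow> 'n heis set \<Rightarrow> bool" where
  "realizes I m a k x t S \<longleftrightarrow>
     rot_sym_hypersurface I x t S \<and> horizontal_arclength I m x t \<and>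
     (\<forall>s\<in>I. \<forall>\<omega>. \<omega> \<noteq> 0 \<longrightarrow> alpha I m x t (s, \<omega>) = a s \<and> k_inv I m x t (s, \<omega>) = k s)"

end

theory Submission
  imports Defs
begin

text \<open>Write \<open>u = \<omega> / |\<omega>|\<close> and \<open>c = x' - i t' / x\<close>. In the left-invariant frame the tangent
  vectors of the hypersurface at \<open>(x u, t)\<close> that lie in the contact bundle are exactly those whose
  horizontal part has Hermitian product with \<open>u\<close> in \<open>\<real> c\<close>. The subspace
  \<open>xi'\<close> is the Hermitian complement of \<open>u\<close>, and the rotated horizontal generating curves have
  velocity \<open>c u\<close>. The parameter is the horizontal arc-length precisely when \<open>|c| = 1\<close>;
  then \<open>e_n = c u\<close>, \<open>e_2n = i c u\<close>, and linear algebra together with one differentiation of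
  \<open>i c u\<close> in the directions of \<open>xi'\<close> gives
  \<open>\<alpha> = x' / x\<close> and \<open>k = - t' / x\<^sup>2\<close>
  (lemmas \<open>alpha_eq\<close> and \<open>k_inv_eq\<close> of the locale \<open>unit_speed_profile\<close>).

  For existence one therefore takes \<open>x = e\<^sup>A\<close>, which solves \<open>x' = a x\<close>, an antiderivative
  \<open>t\<close> of \<open>- k x\<^sup>2\<close>, and an antiderivative \<open>\<theta>\<close> of \<open>k\<close> as horizontal angle. The
  relation \<open>a\<^sup>2 + k\<^sup>2 = e\<^sup>-\<^sup>2\<^sup>A\<close> becomes the arc-length condition.

  For uniqueness the arc-length condition divided by \<open>x\<^sup>2\<close> reads
  \<open>\<alpha>\<^sup>2 + k\<^sup>2 = 1 / x\<^sup>2\<close>. The invariants thus determine \<open>x\<close> algebraically, and with it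
  \<open>t' = - k x\<^sup>2\<close>. Two realizations differ by a constant in \<open>t\<close>, that is, by a
  translation along the centre of the group.\<close>

section \<open>Calculus on an interval\<close>

text \<open>Smoothness is the greatest family of functions closed under differentiation on \<open>I\<close>. Closure
  properties then follow by exhibiting a differentiation-closed family, without a formula for
  higher derivatives.\<close>

lemma smooth_on_coinduct:
  assumes "f \<in> F"
    and step: "\<And>g. g \<in> F \<Longrightarrow> \<exists>g'\<in>F. \<forall>s\<in>I. (g has_real_derivative g' s) (at s within I)"
  shows "smooth_on I f"
proof -
  obtain d where d: "\<And>g. g \<in> F \<Longrightarrow> d g \<in> F \<and> (\<forall>s\<in>I. (g has_real_derivative d g s) (at s within I))"
    using step by metis
  define D where "D i = (d ^^ i) f" for i
  have "D i \<in> F" for i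
    by (induction i) (use assms(1) d in \<open>auto simp: D_def\<close>)
  moreover have "D (Suc i) = d (D i)" for i
    by (simp add: D_def)
  ultimately show ?thesis
    unfolding smooth_on_def using d by (intro exI[of _ D]) (auto simp: D_def)
qed

lemma smooth_on_derivE:
  assumes "smooth_on I f"
  obtains f' where "smooth_on I f'" "\<forall>s\<in>I. (f has_real_derivative f' s) (at s within I)"
proof -
  obtain D where D: "\<forall>s\<in>I. D 0 s = f s"
    "\<forall>i. \<forall>s\<in>I. (D i has_real_derivative D (Suc i) s) (at s within I)"
    using assms unfolding smooth_on_def by blast
  have "smooth_on I (D (Suc 0))"
    unfolding smooth_on_def using D by (intro exI[of _ "\<lambda>i. D (Suc i)"]) auto
  moreover have "(f has_real_derivative D (Suc 0) s) (at s within I)" if "s \<in> I" for s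
    using has_field_derivative_transform_within[of "D 0" "D (Suc 0) s" s I 1 f] D that by auto
  ultimately show ?thesis using that by blast
qed

lemma smooth_on_of_deriv:
  assumes "smooth_on I f'" "\<And>s. s \<in> I \<Longrightarrow> (f has_real_derivative f' s) (at s within I)"
  shows "smooth_on I f"
proof (rule smooth_on_coinduct[of f "insert f (Collect (smooth_on I))"])
  fix g assume "g \<in> insert f (Collect (smooth_on I))"
  then consider "g = f" | "smooth_on I g" by blast
  then show "\<exists>g'\<in>insert f (Collect (smooth_on I)). \<forall>s\<in>I. (g has_real_derivative g' s) (at s within I)"
  proof cases
    case 1
    then show ?thesis using assms by blast
  next
    case 2
    then show ?thesis by (rule smooth_on_derivE) blast
  qed
qed simp

text \<open>By the Leibniz rule a product differentiates to a sum of two products, so sums of products form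
  the family for coinduction on products.\<close>

inductive_set sums_of_products :: "real set \<Rightarrow> (real \<Rightarrow> real) set" for I where
  product: "smooth_on I f \<Longrightarrow> smooth_on I g \<Longrightarrow> (\<lambda>s. f s * g s) \<in> sums_of_products I"
| add: "f \<in> sums_of_products I \<Longrightarrow> g \<in> sums_of_products I \<Longrightarrow> (\<lambda>s. f s + g s) \<in> sums_of_products I"

lemma sums_of_products_deriv:
  assumes "g \<in> sums_of_products I"
  shows "\<exists>g'\<in>sums_of_products I. \<forall>s\<in>I. (g has_real_derivative g' s) (at s within I)"
  using assms
proof induction
  case (product f g)
  obtain f' where f': "smooth_on I f'" "\<forall>s\<in>I. (f has_real_derivative f' s) (at s within I)"
    by (rule smooth_on_derivE[OF product(1)]) blast
  obtain g' where g': "smooth_on I g'" "\<forall>s\<in>I. (g has_real_derivative g' s) (at s within I)"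
    by (rule smooth_on_derivE[OF product(2)]) blast
  have "(\<lambda>s. f' s * g s + f s * g' s) \<in> sums_of_products I"
    using product f' g' by (intro sums_of_products.intros)
  moreover have "((\<lambda>s. f s * g s) has_real_derivative f' s * g s + f s * g' s) (at s within I)"
    if "s \<in> I" for s
    using bspec[OF f'(2) that] bspec[OF g'(2) that] by (auto intro!: derivative_eq_intros)
  ultimately show ?case
    by (intro bexI[of _ "\<lambda>s. f' s * g s + f s * g' s"] ballI)
next
  case (add f g)
  obtain f' where f': "f' \<in> sums_of_products I" "\<forall>s\<in>I. (f has_real_derivative f' s) (at s within I)"
    using add.IH(1) by (rule bexE)
  obtain g' where g': "g' \<in> sums_of_products I" "\<forall>s\<in>I. (g has_real_derivative g' s) (at s within I)"
    using add.IH(2) by (rule bexE)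
  show ?case
    by (intro bexI[of _ "\<lambda>s. f' s + g' s"] sums_of_products.add ballI DERIV_add)
       (use f' g' in auto)
qed

lemma smooth_on_mult:
  assumes "smooth_on I f" "smooth_on I g"
  shows "smooth_on I (\<lambda>s. f s * g s)"
  by (rule smooth_on_coinduct[OF sums_of_products.product[OF assms] sums_of_products_deriv])

lemma smooth_on_add:
  assumes "smooth_on I f" "smooth_on I g"
  shows "smooth_on I (\<lambda>s. f s + g s)"
proof (rule smooth_on_coinduct[of _ "{\<lambda>s. f s + g s | f g. smooth_on I f \<and> smooth_on I g}"])
  fix h assume "h \<in> {\<lambda>s. f s + g s | f g. smooth_on I f \<and> smooth_on I g}"
  then obtain f g where h: "h = (\<lambda>s. f s + g s)" "smooth_on I f" "smooth_on I g" by blast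
  obtain f' where f': "smooth_on I f'" "\<forall>s\<in>I. (f has_real_derivative f' s) (at s within I)"
    by (rule smooth_on_derivE[OF h(2)]) blast
  obtain g' where g': "smooth_on I g'" "\<forall>s\<in>I. (g has_real_derivative g' s) (at s within I)"
    by (rule smooth_on_derivE[OF h(3)]) blast
  show "\<exists>h'\<in>{\<lambda>s. f s + g s | f g. smooth_on I f \<and> smooth_on I g}.
      \<forall>s\<in>I. (h has_real_derivative h' s) (at s within I)"
    using h f' g' by (intro bexI[of _ "\<lambda>s. f' s + g' s"]) (auto intro: DERIV_add)
qed (use assms in blast)

lemma smooth_on_const: "smooth_on I (\<lambda>s. c)"
  unfolding smooth_on_def by (intro exI[of _ "\<lambda>i s. if i = 0 then c else 0"]) auto

text \<open>The family here is \<open>e\<^sup>A g\<close> with \<open>g\<close> smooth, since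
  \<open>(e\<^sup>A g)' = e\<^sup>A (a g + g')\<close>.\<close>

lemma smooth_on_exp_antiderivative:
  assumes "smooth_on I a" "\<And>s. s \<in> I \<Longrightarrow> (A has_real_derivative a s) (at s within I)"
  shows "smooth_on I (\<lambda>s. exp (A s))"
proof (rule smooth_on_coinduct[of _ "{\<lambda>s. exp (A s) * g s | g. smooth_on I g}"])
  show "(\<lambda>s. exp (A s)) \<in> {\<lambda>s. exp (A s) * g s |g. smooth_on I g}"
    using smooth_on_const[of I 1] by force
next
  fix h assume "h \<in> {\<lambda>s. exp (A s) * g s | g. smooth_on I g}"
  then obtain g where h: "h = (\<lambda>s. exp (A s) * g s)" "smooth_on I g" by blast
  obtain g' where g': "smooth_on I g'" "\<forall>s\<in>I. (g has_real_derivative g' s) (at s within I)"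
    by (rule smooth_on_derivE[OF h(2)]) blast
  have "smooth_on I (\<lambda>s. a s * g s + g' s)"
    by (intro smooth_on_add smooth_on_mult assms h g')
  moreover have "(h has_real_derivative exp (A s) * (a s * g s + g' s)) (at s within I)" if "s \<in> I" for s
    unfolding h using assms(2)[OF that] bspec[OF g'(2) that]
    by (auto intro!: derivative_eq_intros simp: algebra_simps)
  ultimately show "\<exists>h'\<in>{\<lambda>s. exp (A s) * g s | g. smooth_on I g}.
      \<forall>s\<in>I. (h has_real_derivative h' s) (at s within I)"
    by (intro bexI[of _ "\<lambda>s. exp (A s) * (a s * g s + g' s)"] ballI) auto
qed

text \<open>Reduces differentiation within an interval of any kind to a compact subinterval. If \<open>s\<close>
  is an endpoint of \<open>I\<close>, it becomes an endpoint of the subinterval as well; otherwise the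
  subinterval extends beyond \<open>s\<close> on both sides. The base point \<open>c\<close> is included so that an
  integral from \<open>c\<close> can be computed inside the subinterval.\<close>

lemma interval_at_within_cbox:
  fixes I :: "real set"
  assumes "is_interval I" "s \<in> I" "c \<in> I"
  obtains l r where "l \<le> c" "c \<le> r" "s \<in> {l..r}" "{l..r} \<subseteq> I" "at s within I = at s within {l..r}"
proof -
  obtain l where l: "l \<in> I" "l \<le> c" "l \<le> s" "\<And>u. u \<in> I \<Longrightarrow> u < s \<Longrightarrow> l < s"
  proof (cases "\<exists>u\<in>I. u < s")
    case True
    then obtain u where "u \<in> I" "u < s" by blast
    then show ?thesis using that[of "min u c"] assms by (auto simp: min_def)
  next
    case False
    then show ?thesis using that[of s] assms by force
  qed
  obtain r where r: "r \<in> I" "c \<le> r" "s \<le> r" "\<And>u. u \<in> I \<Longrightarrow> s < u \<Longrightarrow> s < r"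
  proof (cases "\<exists>u\<in>I. s < u")
    case True
    then obtain u where "u \<in> I" "s < u" by blast
    then show ?thesis using that[of "max u c"] assms by (auto simp: max_def)
  next
    case False
    then show ?thesis using that[of s] assms by force
  qed
  have sub: "{l..r} \<subseteq> I"
    using mem_is_interval_1_I[OF assms(1) l(1) r(1)] by auto
  define U where "U = {(if l < s then l else s - 1)<..<(if s < r then r else s + 1)}"
  have "at s within I = at s within {l..r}"
  proof (rule at_within_nhd[of s U])
    show "I \<inter> U - {s} = {l..r} \<inter> U - {s}"
    proof (intro set_eqI iffI)
      fix u assume u: "u \<in> I \<inter> U - {s}"
      have "l \<le> u"
      proof (cases "u < s")
        case True
        then have "l < s" using l(4) u by blast
        then show ?thesis using u by (simp add: U_def)
      qed (use l(3) in simp)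
      moreover have "u \<le> r"
      proof (cases "s < u")
        case True
        then have "s < r" using r(4) u by blast
        then show ?thesis using u by (simp add: U_def)
      qed (use r(3) in simp)
      ultimately show "u \<in> {l..r} \<inter> U - {s}" using u by simp
    qed (use sub in auto)
  qed (auto simp: U_def)
  then show ?thesis
    using l(3) r(3) by (intro that[OF l(2) r(2) _ sub]) auto
qed

lemma antiderivative_on_interval:
  fixes f :: "real \<Rightarrow> real"
  assumes I: "is_interval I" and f: "continuous_on I f"
  obtains F where "\<And>s. s \<in> I \<Longrightarrow> (F has_real_derivative f s) (at s within I)"
proof (cases "I = {}")
  case False
  then obtain c where c: "c \<in> I" by blast
  \<comment> \<open>an integral over a reversed interval is 0, so this is the oriented integral from c to s\<close>
  define F where "F s = integral {c..s} f - integral {s..c} f" for s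
  have "(F has_real_derivative f s) (at s within I)" if s: "s \<in> I" for s
  proof -
    obtain l r where lr: "l \<le> c" "c \<le> r" "s \<in> {l..r}" "{l..r} \<subseteq> I"
      "at s within I = at s within {l..r}"
      by (rule interval_at_within_cbox[OF I s c])
    have cont: "continuous_on {l..r} f"
      using f lr continuous_on_subset by blast
    have int: "f integrable_on {p..q}" if "l \<le> p" "q \<le> r" for p q
      using continuous_on_subset[OF cont] that by (intro integrable_continuous_real) auto
    have F: "F u = integral {l..u} f - integral {l..c} f" if u: "u \<in> {l..r}" for u
    proof (cases "c \<le> u")
      case True
      have "integral {l..c} f + integral {c..u} f = integral {l..u} f"
        using True u lr by (intro Henstock_Kurzweil_Integration.integral_combine int) auto
      then show ?thesis using True by (cases "c = u") (auto simp: F_def)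
    next
      case False
      have "integral {l..u} f + integral {u..c} f = integral {l..c} f"
        using False u lr by (intro Henstock_Kurzweil_Integration.integral_combine int) auto
      then show ?thesis using False by (auto simp: F_def)
    qed
    have "((\<lambda>u. integral {l..u} f) has_real_derivative f s) (at s within {l..r})"
      using integral_has_real_derivative[OF cont lr(3)] .
    then have "((\<lambda>u. integral {l..u} f - integral {l..c} f) has_real_derivative f s) (at s within {l..r})"
      by (auto intro!: derivative_eq_intros)
    then have "(F has_real_derivative f s) (at s within {l..r})"
      using has_field_derivative_transform_within[of _ "f s" s "{l..r}" 1 F] F lr(3) by auto
    then show ?thesis using lr by simp
  qed
  then show ?thesis using that by blast
qed (use that in blast)

lemma smooth_on_continuous:
  assumes "smooth_on I f"
  shows "continuous_on I f"
  by (rule smooth_on_derivE[OF assms])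
     (auto simp: continuous_on_eq_continuous_within intro: DERIV_continuous)

text \<open>Derivatives within \<open>I\<close> are unique because every point of \<open>I\<close>, endpoints included, can be
  approached inside \<open>I\<close>.\<close>

lemma interval_not_trivial:
  fixes I :: "real set"
  assumes "is_interval I" "interior I \<noteq> {}" "s \<in> I" "0 < e"
  shows "\<exists>d. 0 < \<bar>d\<bar> \<and> \<bar>d\<bar> < e \<and> s + d \<in> I"
proof -
  obtain p where "p \<in> interior I" using assms(2) by blast
  then obtain r where r: "0 < r" "ball p r \<subseteq> I" by (auto simp: mem_interior)
  then have "p \<in> I" "p + r/2 \<in> I" by (auto simp: dist_norm subset_eq)
  then obtain q where q: "q \<in> I" "q \<noteq> s" using r by (cases "p = s") auto
  define d where "d = (if s < q then min (e/2) (q - s) else - min (e/2) (s - q))"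
  have "0 < \<bar>d\<bar>" "\<bar>d\<bar> < e" using q assms(4) by (auto simp: d_def)
  moreover have "s + d \<in> I"
  proof (cases "s < q")
    case True
    then show ?thesis
      using mem_is_interval_1_I[OF assms(1,3) q(1)] assms(4) by (auto simp: d_def)
  next
    case False
    then show ?thesis
      using mem_is_interval_1_I[OF assms(1) q(1) assms(3)] assms(4) by (auto simp: d_def)
  qed
  ultimately show ?thesis by blast
qed

lemma vector_derivative_on_interval:
  fixes I :: "real set" and f :: "real \<Rightarrow> 'a::real_normed_vector"
  assumes "is_interval I" "interior I \<noteq> {}" "s \<in> I"
    and "(f has_vector_derivative f') (at s within I)"
  shows "vector_derivative f (at s within I) = f'"
proof (rule vector_derivative_within[OF _ assms(4)])
  show "at s within I \<noteq> bot"
    unfolding trivial_limit_within islimpt_approachable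
  proof (intro notI, elim notE, intro allI impI)
    fix e :: real assume "0 < e"
    then obtain d where "0 < \<bar>d\<bar>" "\<bar>d\<bar> < e" "s + d \<in> I"
      using interval_not_trivial[OF assms(1-3)] by blast
    then show "\<exists>x'\<in>I. x' \<noteq> s \<and> dist x' s < e"
      by (intro bexI[of _ "s + d"]) (auto simp: dist_norm)
  qed
qed

section \<open>Hermitian geometry of the frame coefficients\<close>

text \<open>Antilinear in the first argument, so that \<open>herm u\<close> is complex linear and extracts the
  coefficient of a unit vector \<open>u\<close>.\<close>

definition herm :: "complex^'n::finite \<Rightarrow> complex^'n \<Rightarrow> complex" where
  "herm u v = (\<Sum>j\<in>UNIV. cnj (u $ j) * v $ j)"

lemma herm_diff_right: "herm u (v - w) = herm u v - herm u w"
  by (simp add: herm_def right_diff_distrib sum_subtractf)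

lemma herm_scale_right: "herm u (c *s v) = c * herm u v"
  by (simp add: herm_def sum_distrib_left mult_ac)

lemma herm_scale_left: "herm (c *s u) v = cnj c * herm u v"
  by (simp add: herm_def sum_distrib_left mult_ac)

lemma herm_scaleR_left: "herm (r *\<^sub>R u) v = r *\<^sub>R herm u v"
  by (simp add: herm_def scaleR_sum_right)

lemma herm_scaleR_right: "herm u (r *\<^sub>R v) = r *\<^sub>R herm u v"
  by (simp add: herm_def scaleR_sum_right)

lemma herm_minus_right: "herm u (- v) = - herm u v"
  by (simp add: herm_def sum_negf)

lemma inner_eq_Re_herm: "inner u v = Re (herm u v)"
  by (simp add: herm_def inner_vec_def inner_complex_def)

lemma herm_self: "herm u u = complex_of_real ((norm u)\<^sup>2)"
proof -
  have "Im (herm u u) = 0"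
    by (simp add: herm_def)
  moreover have "Re (herm u u) = (norm u)\<^sup>2"
    by (metis inner_eq_Re_herm power2_norm_eq_inner)
  ultimately show ?thesis
    by (simp add: complex_eq_iff)
qed

lemma norm_scale: "norm (c *s (v :: complex^'n::finite)) = cmod c * norm v"
proof -
  have "complex_of_real ((norm (c *s v))\<^sup>2) = (c * cnj c) * complex_of_real ((norm v)\<^sup>2)"
    by (simp only: herm_self[symmetric] herm_scale_left herm_scale_right mult_ac)
  also have "\<dots> = complex_of_real ((cmod c * norm v)\<^sup>2)"
    by (simp add: complex_norm_square[symmetric] power_mult_distrib flip: of_real_power)
  finally have "(norm (c *s v))\<^sup>2 = (cmod c * norm v)\<^sup>2"
    by (simp only: of_real_eq_iff)
  then show ?thesis by simp
qed

lemma herm_axis: "herm (axis m 1) v = v $ m"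
  by (simp add: herm_def axis_def if_distrib[where f=cnj] if_distrib[where f="\<lambda>z. z * _"] cong: if_cong)

lemma scaleR_eq_scale: "r *\<^sub>R (v::complex^'n::finite) = complex_of_real r *s v"
  by (subst vec_eq_iff) (auto simp: complex_eq_iff)

lemma scale_combination:
  "- (c *s z) + r *\<^sub>R (d *s z) = (complex_of_real r * d - c) *s (z :: complex^'n::finite)"
  by (subst vec_eq_iff) (simp add: complex_eq_iff algebra_simps)

lemma contact_form_eq: "contact_form p v = snd v + Im (herm (fst p) (fst v))"
  by (simp add: contact_form_def herm_def mult.commute)

lemma of_coeffs_eq: "of_coeffs p c = (fst c, snd c - Im (herm (fst p) (fst c)))"
proof (rule prod_eqI)
  have "snd (of_coeffs p c) + Im (herm (fst p) (fst (of_coeffs p c))) = snd c"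
    using coeffs_of_coeffs[of p c] by (metis coeffs_def contact_form_eq snd_conv)
  then show "snd (of_coeffs p c) = snd (fst c, snd c - Im (herm (fst p) (fst c)))"
    by (simp add: fst_of_coeffs)
qed (simp add: fst_of_coeffs)

lemma levi_eq: "levi p v w = inner (fst v) (fst w)"
  by (simp add: levi_def coeffs_def inner_vec_def inner_complex_def)

lemma J_eq: "J p v = of_coeffs p (\<i> *s fst v, 0)"
  by (simp add: J_def of_coeffs_def coeffs_def reeb_def zero_prod_def algebra_simps)

lemma contact_vector_eq_iff:
  assumes "contact_form p v = 0"
  shows "v = of_coeffs p (w, 0) \<longleftrightarrow> fst v = w"
  using assms by (auto simp: of_coeffs_eq contact_form_eq prod_eq_iff)

lemma contact_form_of_coeffs [simp]: "contact_form p (of_coeffs p c) = snd c"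
  by (simp add: of_coeffs_eq contact_form_eq)

lemma ex_herm_orthogonal:
  fixes u :: "complex^'n::finite"
  assumes "CARD('n) \<ge> 2"
  obtains w where "w \<noteq> 0" "herm u w = 0"
proof -
  obtain i j :: 'n where ij: "i \<noteq> j"
    using assms by (metis card_2_iff' ex_card)
  define w where "w = (if u $ i = 0 then axis i 1
    else cnj (u $ j) *s axis i 1 - cnj (u $ i) *s axis j 1)"
  have ax: "herm u (axis l 1) = cnj (u $ l)" for l
    by (simp add: herm_def axis_def if_distrib[where f="\<lambda>z. _ * z"] cong: if_cong)
  have "herm u w = 0"
    by (simp add: w_def ax herm_diff_right herm_scale_right)
  moreover have "w \<noteq> 0"
  proof (cases "u $ i = 0")
    case True
    then show ?thesis by (simp add: w_def axis_eq_0_iff)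
  next
    case False
    then have "w $ j \<noteq> 0" using ij by (simp add: w_def axis_def)
    then show ?thesis by force
  qed
  ultimately show ?thesis using that by blast
qed

definition ctranspose :: "complex^'n^'n::finite \<Rightarrow> complex^'n^'n" where
  "ctranspose A = (\<chi> i j. cnj (A $ j $ i))"

lemma herm_ctranspose: "herm (A *v u) v = herm u (ctranspose A *v v)"
proof -
  have "herm (A *v u) v = (\<Sum>i\<in>UNIV. \<Sum>j\<in>UNIV. cnj (A $ i $ j) * cnj (u $ j) * v $ i)"
    by (simp add: herm_def matrix_vector_mult_def sum_distrib_right)
  also have "\<dots> = (\<Sum>j\<in>UNIV. \<Sum>i\<in>UNIV. cnj (A $ i $ j) * cnj (u $ j) * v $ i)"
    by (rule sum.swap)
  also have "\<dots> = herm u (ctranspose A *v v)"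
    by (simp add: herm_def matrix_vector_mult_def ctranspose_def sum_distrib_left mult_ac)
  finally show ?thesis .
qed

lemma unitary_iff: "unitary A \<longleftrightarrow> A ** ctranspose A = mat 1"
  by (simp add: unitary_def ctranspose_def)

lemma unitary_ctranspose: "unitary A \<Longrightarrow> ctranspose A ** A = mat 1"
  unfolding unitary_iff using matrix_left_right_inverse by blast

lemma ctranspose_ctranspose: "ctranspose (ctranspose A) = A"
  by (simp add: ctranspose_def vec_eq_iff)

lemma unitary_norm:
  assumes "unitary A"
  shows "norm (A *v z) = norm z"
proof -
  have "herm (A *v z) (A *v z) = herm z z"
    by (simp add: herm_ctranspose matrix_vector_mul_assoc unitary_ctranspose[OF assms])
  then have "(norm (A *v z))\<^sup>2 = (norm z)\<^sup>2"
    by (metis herm_self of_real_eq_iff)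
  then show ?thesis by simp
qed

text \<open>With \<open>v = e - b\<close>, where \<open>e\<close> is the \<open>m\<close>-th basis vector, the map
  \<open>z - \<tau> \<langle>v, z\<rangle> v\<close> with \<open>\<tau> = 1 / \<langle>v, e\<rangle>\<close> takes \<open>e\<close> to \<open>e - v = b\<close>. It is
  unitary iff \<open>\<tau> + cnj \<tau> = |\<tau>|\<^sup>2 |v|\<^sup>2\<close>, which amounts to
  \<open>2 Re \<langle>v, e\<rangle> = |v|\<^sup>2\<close> and holds as \<open>e\<close> and \<open>b\<close> have the same norm.\<close>

lemma unitary_transitive:
  fixes b :: "complex^'n::finite"
  assumes "norm b = 1"
  obtains A where "unitary A" "A *v axis m 1 = b"
proof -
  define v where "v = axis m 1 - b"
  \<comment> \<open>if b is the basis vector itself, then v = 0 and the value 1 / 0 = 0 makes A the identity\<close>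
  define \<tau> where "\<tau> = 1 / cnj (v $ m)"
  define A where "A = (\<chi> i j. (if i = j then 1 else 0) - \<tau> * v $ i * cnj (v $ j))"
  have norm_v: "herm v v = v $ m + cnj (v $ m)"
  proof -
    have "inner (axis m 1) b = Re (b $ m)" "inner b (axis m 1) = Re (b $ m)"
      by (simp_all add: inner_eq_Re_herm[of "axis m 1"] herm_axis inner_commute[of b "axis m 1"])
    moreover have "inner b b = 1" "inner (axis m 1) (axis m (1::complex)) = 1"
      using assms by (simp_all add: norm_eq_1 inner_axis_axis inner_complex_def)
    ultimately have "(norm v)\<^sup>2 = 2 - 2 * Re (b $ m)"
      by (simp add: v_def power2_norm_eq_inner inner_diff_left inner_diff_right)
    then show ?thesis
      unfolding herm_self by (simp add: v_def complex_eq_iff)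
  qed
  have v0: "v = 0" if "v $ m = 0"
    using norm_v that unfolding herm_self by simp
  have \<tau>: "\<tau> + cnj \<tau> = \<tau> * cnj \<tau> * herm v v"
    unfolding norm_v by (cases "v $ m = 0") (auto simp: \<tau>_def field_simps)
  have "A ** ctranspose A = mat 1"
  proof -
    have "(\<Sum>j\<in>UNIV. A $ i $ j * cnj (A $ l $ j)) = (if i = l then 1 else 0)" for i l
    proof -
      have "(\<Sum>j\<in>UNIV. A $ i $ j * cnj (A $ l $ j)) =
          (\<Sum>j\<in>UNIV. (if i = j then (if l = j then 1 else 0) else 0)
             - (if i = j then cnj \<tau> * cnj (v $ l) * v $ j else 0)
             - (if l = j then \<tau> * v $ i * cnj (v $ j) else 0)
             + \<tau> * cnj \<tau> * v $ i * cnj (v $ l) * (cnj (v $ j) * v $ j))"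
        by (intro sum.cong) (auto simp: A_def algebra_simps)
      also have "\<dots> = (if i = l then 1 else 0)
          - v $ i * cnj (v $ l) * (\<tau> + cnj \<tau> - \<tau> * cnj \<tau> * herm v v)"
        by (simp add: sum.distrib sum_subtractf herm_def flip: sum_distrib_left)
           (simp add: algebra_simps)
      finally show ?thesis using \<tau> by simp
    qed
    then show ?thesis
      by (simp add: vec_eq_iff matrix_matrix_mult_def ctranspose_def mat_def)
  qed
  moreover have "A *v axis m 1 = b"
  proof -
    have "(A *v axis m 1) $ i = A $ i $ m" for i
      by (simp add: matrix_vector_mult_def axis_def if_distrib[where f="\<lambda>z. _ * z"] cong: if_cong)
    moreover have "A $ i $ m = b $ i" for i
    proof (cases "v $ m = 0")
      case True
      then show ?thesis using v0 by (simp add: A_def v_def axis_def vec_eq_iff)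
    next
      case False
      then have "A $ i $ m = (if i = m then 1 else 0) - v $ i"
        by (simp add: A_def \<tau>_def)
      then show ?thesis by (simp add: v_def axis_def)
    qed
    ultimately show ?thesis by (simp add: vec_eq_iff)
  qed
  ultimately show ?thesis using that unitary_iff by blast
qed

lemma rot_image_of_norm_set:
  assumes "unitary A"
  shows "rot A ` {(z, \<tau>). P (norm z) \<tau>} = {(z, \<tau>). P (norm z) \<tau>}"
proof (intro equalityI subsetI)
  fix p :: "'a heis" assume "p \<in> {(z, \<tau>). P (norm z) \<tau>}"
  then have "P (norm (fst p)) (snd p)" by auto
  moreover have "unitary (ctranspose A)"
    using unitary_ctranspose[OF assms] by (simp add: unitary_iff ctranspose_ctranspose)
  moreover have "p = rot A (ctranspose A *v fst p, snd p)"
    using assms by (simp add: rot_def unitary_iff matrix_vector_mul_assoc)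
  ultimately show "p \<in> rot A ` {(z, \<tau>). P (norm z) \<tau>}"
    by (intro image_eqI[where x = "(ctranspose A *v fst p, snd p)"]) (simp_all add: unitary_norm)
qed (auto simp: rot_def unitary_norm[OF assms])

section \<open>Differentiation on the parameter domain\<close>

lemma has_derivative_sgn_vec:
  fixes \<omega> :: "'a::real_inner"
  assumes "\<omega> \<noteq> 0"
  shows "(sgn has_derivative (\<lambda>h. (h - inner (sgn \<omega>) h *\<^sub>R sgn \<omega>) /\<^sub>R norm \<omega>)) (at \<omega>)"
proof -
  have "((\<lambda>w. inverse (norm w) *\<^sub>R w) has_derivative
     (\<lambda>h. inverse (norm \<omega>) *\<^sub>R h + (- (inverse (norm \<omega>) * inner (sgn \<omega>) h * inverse (norm \<omega>))) *\<^sub>R \<omega>)) (at \<omega>)"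
    using assms by (auto intro!: derivative_eq_intros has_derivative_norm simp: fun_eq_iff inner_commute)
  then show ?thesis
    by (simp add: sgn_div_norm[abs_def] divide_inverse_commute algebra_simps scaleR_diff_right)
qed

text \<open>The parameter domain contains small steps along each coordinate direction: in \<open>s\<close> because \<open>I\<close>
  is a nondegenerate interval, in \<open>\<omega>\<close> because the complement of the origin is open.\<close>

lemma derivative_param_domain_unique:
  fixes f :: "real \<times> (complex^'n::finite) \<Rightarrow> 'b::real_normed_vector"
  assumes "is_interval I" "interior I \<noteq> {}" "s \<in> I" "\<omega> \<noteq> 0"
    and "(f has_derivative D) (at (s, \<omega>) within param_domain I)"
    and "(f has_derivative E) (at (s, \<omega>) within param_domain I)"
  shows "D = E"
proof (rule frechet_derivative_unique_within[OF assms(5,6)])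
  fix i :: "real \<times> (complex^'n)" and e :: real
  assume i: "i \<in> Basis" and e: "e > 0"
  consider "i = (1, 0)" | j where "i = (0, j)" "j \<in> Basis"
    using i by (auto simp: Basis_prod_def)
  then show "\<exists>d. 0 < \<bar>d\<bar> \<and> \<bar>d\<bar> < e \<and> (s, \<omega>) + d *\<^sub>R i \<in> param_domain I"
  proof cases
    case 1
    then show ?thesis
      using interval_not_trivial[OF assms(1-3) e] assms(4) by (auto simp: param_domain_def)
  next
    case 2
    define d where "d = min (e/2) (norm \<omega> / 2)"
    have d: "0 < d" "d < e" "d < norm \<omega>"
      using assms(4) e by (auto simp: d_def min_def)
    have "\<omega> + d *\<^sub>R j \<noteq> 0"
    proof
      assume "\<omega> + d *\<^sub>R j = 0"
      then have "norm \<omega> = norm (d *\<^sub>R j)" by (metis add_eq_0_iff norm_minus_cancel)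
      then show False using d 2 by (simp add: norm_Basis)
    qed
    then show ?thesis
      using d 2 assms(3) by (intro exI[of _ d]) (auto simp: param_domain_def)
  qed
qed


lemma bounded_bilinear_scale: "bounded_bilinear ((*s) :: complex \<Rightarrow> complex^'n::finite \<Rightarrow> complex^'n)"
  unfolding bilinear_conv_bounded_bilinear[symmetric] bilinear_def
  by (auto intro!: linearI simp: scaleR_eq_scale vector_smult_assoc vector_sadd_rdistrib vector_add_ldistrib mult.commute)
     (simp_all add: scaleR_conv_of_real vec_eq_iff mult_ac)

lemma has_derivative_comp_fst:
  assumes "(f has_vector_derivative f') (at s within I)"
  shows "((\<lambda>q. f (fst q)) has_derivative (\<lambda>h. fst h *\<^sub>R f')) (at (s, \<omega>) within param_domain I)"
proof -
  have "(f has_derivative (\<lambda>h. h *\<^sub>R f')) (at (fst (s, \<omega>)) within fst ` param_domain I)"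
    using assms unfolding has_vector_derivative_def
    by (auto simp: param_domain_def intro: has_derivative_subset)
  then show ?thesis
    by (rule has_derivative_in_compose[rotated]) (auto intro!: derivative_eq_intros)
qed

text \<open>Both the horizontal part of the immersion and the frame coefficients of \<open>e_2n\<close> are fields of the
  form \<open>c(s) \<omega> / |\<omega>|\<close> with a complex-valued \<open>c\<close>.\<close>

lemma has_derivative_direction_field:
  fixes \<omega> :: "complex^'n::finite"
  assumes "(c has_vector_derivative c') (at s within I)" "\<omega> \<noteq> 0"
  shows "((\<lambda>q. c (fst q) *s sgn (snd q)) has_derivative
      (\<lambda>h. c s *s ((snd h - inner (sgn \<omega>) (snd h) *\<^sub>R sgn \<omega>) /\<^sub>R norm \<omega>) + (fst h *\<^sub>R c') *s sgn \<omega>))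
      (at (s, \<omega>) within param_domain I)"
proof -
  have "((\<lambda>q. sgn (snd q)) has_derivative
      (\<lambda>h. (snd h - inner (sgn \<omega>) (snd h) *\<^sub>R sgn \<omega>) /\<^sub>R norm \<omega>)) (at (s, \<omega>) within param_domain I)"
    using has_derivative_compose[of snd snd "(s, \<omega>)" "param_domain I" sgn
        "\<lambda>h. (h - inner (sgn \<omega>) h *\<^sub>R sgn \<omega>) /\<^sub>R norm \<omega>"]
      has_derivative_sgn_vec[OF assms(2)] 
      bounded_linear.has_derivative[OF bounded_linear_snd has_derivative_ident, of "(at (s, \<omega>) within param_domain I)"]
    by simp
  from bounded_bilinear.FDERIV[OF bounded_bilinear_scale has_derivative_comp_fst[OF assms(1)] this]
  show ?thesis by simp
qed

section \<open>The invariants of a profile of unit horizontal speed\<close>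

text \<open>The choice \<open>\<theta>' = - t' / x\<^sup>2\<close> turns the velocity of \<open>x e\<^sup>i\<^sup>\<theta>\<close> into
  \<open>(x' - i t' / x) e\<^sup>i\<^sup>\<theta>\<close>.\<close>

lemma has_vector_derivative_rot_horizontal_curve:
  assumes x: "(x has_real_derivative x') (at s within I)"
    and t: "(t has_real_derivative t') (at s within I)"
    and \<theta>: "(\<theta> has_real_derivative - t' / (x s)\<^sup>2) (at s within I)"
    and pos: "0 < x s"
  shows "((\<lambda>\<sigma>. rot A (horizontal_curve m x t \<theta> \<sigma>)) has_vector_derivative
      (Complex x' (- t' / x s) *s (cis (\<theta> s) *s (A *v axis m 1)), t')) (at s within I)"
proof -
  let ?b = "A *v axis m 1"
  have z: "((\<lambda>\<sigma>. Complex (x \<sigma> * cos (\<theta> \<sigma>)) (x \<sigma> * sin (\<theta> \<sigma>))) has_vector_derivative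
      Complex x' (- t' / x s) * cis (\<theta> s)) (at s within I)"
    unfolding has_vector_derivative_complex_iff
    using x \<theta> pos by (auto intro!: derivative_eq_intros simp: power2_eq_square field_simps)
  have "rot A (horizontal_curve m x t \<theta> \<sigma>) = (Complex (x \<sigma> * cos (\<theta> \<sigma>)) (x \<sigma> * sin (\<theta> \<sigma>)) *s ?b, t \<sigma>)" for \<sigma>
  proof -
    have "axis m z = z *s axis m (1::complex)" for z
      by (simp add: vec_eq_iff axis_def)
    then show ?thesis
      unfolding rot_def horizontal_curve_def by (metis fst_conv snd_conv vector_scalar_commute)
  qed
  moreover have "((\<lambda>\<sigma>. (Complex (x \<sigma> * cos (\<theta> \<sigma>)) (x \<sigma> * sin (\<theta> \<sigma>)) *s ?b, t \<sigma>)) has_vector_derivative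
      ((Complex x' (- t' / x s) * cis (\<theta> s)) *s ?b, t')) (at s within I)"
    using t unfolding has_real_derivative_iff_has_vector_derivative
    by (intro has_vector_derivative_Pair
        bounded_linear.has_vector_derivative[OF bounded_bilinear.bounded_linear_left[OF bounded_bilinear_scale] z])
  ultimately show ?thesis
    by (simp add: vector_smult_assoc)
qed

locale unit_speed_profile =
  fixes I :: "real set" and m :: "'n::finite" and x x1 x2 t t1 t2 \<theta> :: "real \<Rightarrow> real"
  assumes interval: "is_interval I" and nontrivial: "interior I \<noteq> {}"
    and dx: "s \<in> I \<Longrightarrow> (x has_real_derivative x1 s) (at s within I)"
    and dx1: "s \<in> I \<Longrightarrow> (x1 has_real_derivative x2 s) (at s within I)"
    and dt: "s \<in> I \<Longrightarrow> (t has_real_derivative t1 s) (at s within I)"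
    and dt1: "s \<in> I \<Longrightarrow> (t1 has_real_derivative t2 s) (at s within I)"
    and pos: "s \<in> I \<Longrightarrow> 0 < x s"
    and angle: "horizontal_angle I x t \<theta>"
    and unit_speed: "s \<in> I \<Longrightarrow> (x1 s)\<^sup>2 + (t1 s / x s)\<^sup>2 = 1"
begin

definition velocity :: "real \<Rightarrow> complex" where
  "velocity s = Complex (x1 s) (- t1 s / x s)"

lemma norm_velocity: "s \<in> I \<Longrightarrow> norm (velocity s) = 1"
  using unit_speed[of s] by (simp add: velocity_def cmod_def power_divide)

lemma velocity_nonzero: "s \<in> I \<Longrightarrow> velocity s \<noteq> 0"
  using norm_velocity by force

lemma vector_derivatives:
  assumes "s \<in> I"
  shows "vector_derivative x (at s within I) = x1 s" "vector_derivative t (at s within I) = t1 s"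
  using vector_derivative_on_interval[OF interval nontrivial assms] dx[OF assms] dt[OF assms]
  by (simp_all add: has_real_derivative_iff_has_vector_derivative)

lemma velocity_derivative:
  assumes "s \<in> I"
  shows "(velocity has_vector_derivative Complex (x2 s) ((t1 s * x1 s - t2 s * x s) / (x s)\<^sup>2)) (at s within I)"
  unfolding has_vector_derivative_complex_iff velocity_def
  using dx[OF assms] dx1[OF assms] dt1[OF assms] pos[OF assms]
  by (auto intro!: derivative_eq_intros simp: power2_eq_square diff_divide_distrib)

lemma immersion_derivative:
  assumes "s \<in> I" "\<omega> \<noteq> 0"
  shows "(immersion x t has_derivative
      (\<lambda>h. (x s *\<^sub>R ((snd h - inner (sgn \<omega>) (snd h) *\<^sub>R sgn \<omega>) /\<^sub>R norm \<omega>) + (fst h * x1 s) *\<^sub>R sgn \<omega>,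
            fst h * t1 s)))
      (at (s, \<omega> :: complex^'n) within param_domain I)"
proof -
  have "((\<lambda>\<sigma>. complex_of_real (x \<sigma>)) has_vector_derivative complex_of_real (x1 s)) (at s within I)"
    using dx[OF assms(1)] by (auto intro: has_vector_derivative_of_real
        simp: has_real_derivative_iff_has_vector_derivative)
  from has_derivative_direction_field[OF this assms(2)]
  have "((\<lambda>q. x (fst q) *\<^sub>R sgn (snd q)) has_derivative
      (\<lambda>h. x s *\<^sub>R ((snd h - inner (sgn \<omega>) (snd h) *\<^sub>R sgn \<omega>) /\<^sub>R norm \<omega>) + (fst h * x1 s) *\<^sub>R sgn \<omega>))
      (at (s, \<omega>) within param_domain I)"
    by (simp add: scaleR_eq_scale[symmetric] scaleR_conv_of_real of_real_mult[symmetric] del: of_real_mult)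
  moreover have "((\<lambda>q. t (fst q)) has_derivative (\<lambda>h. fst h * t1 s)) (at (s, \<omega>) within param_domain I)"
    using has_derivative_comp_fst[of t "t1 s" s I \<omega>] dt[OF assms(1)]
    by (simp add: has_real_derivative_iff_has_vector_derivative)
  ultimately show ?thesis
    unfolding immersion_def[abs_def] by (rule has_derivative_Pair)
qed

lemma immersion_derivative_unique:
  assumes "s \<in> I" "\<omega> \<noteq> 0" "(immersion x t has_derivative D) (at (s, \<omega> :: complex^'n) within param_domain I)"
  shows "D h = (x s *\<^sub>R ((snd h - inner (sgn \<omega>) (snd h) *\<^sub>R sgn \<omega>) /\<^sub>R norm \<omega>) + (fst h * x1 s) *\<^sub>R sgn \<omega>,
            fst h * t1 s)"
  using derivative_param_domain_unique[OF interval nontrivial assms(1-3) immersion_derivative[OF assms(1,2)]]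
  by simp

text \<open>The differential reaches every horizontal vector real-orthogonal to \<open>u\<close>, together with the
  velocity \<open>(x' u, t')\<close> of the profile; only the component along \<open>u\<close> and the \<open>t\<close>-component are tied
  to each other.\<close>

lemma tangent_space_eq:
  assumes "s \<in> I" "\<omega> \<noteq> 0"
  shows "tangent_space I x t (s, \<omega> :: complex^'n) =
    {v. \<exists>a. snd v = a * t1 s \<and> inner (sgn \<omega>) (fst v) = a * x1 s}"
proof (intro equalityI subsetI)
  have u: "inner (sgn \<omega>) (sgn \<omega>) = 1"
    using assms(2) by (metis norm_eq_1 norm_sgn)
  {
    fix v assume "v \<in> tangent_space I x t (s, \<omega>)"
    then obtain D h where "(immersion x t has_derivative D) (at (s, \<omega>) within param_domain I)" "v = D h"
      unfolding tangent_space_def by blast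
    then have v: "v = (x s *\<^sub>R ((snd h - inner (sgn \<omega>) (snd h) *\<^sub>R sgn \<omega>) /\<^sub>R norm \<omega>) + (fst h * x1 s) *\<^sub>R sgn \<omega>,
            fst h * t1 s)"
      using immersion_derivative_unique[OF assms] by blast
    have "inner (sgn \<omega>) (fst v) = fst h * x1 s"
      unfolding v by (simp add: inner_add_right inner_diff_right u)
    then show "v \<in> {v. \<exists>a. snd v = a * t1 s \<and> inner (sgn \<omega>) (fst v) = a * x1 s}"
      unfolding v by auto
  next
    fix v :: "'n heis" assume "v \<in> {v. \<exists>a. snd v = a * t1 s \<and> inner (sgn \<omega>) (fst v) = a * x1 s}"
    then obtain a where a: "snd v = a * t1 s" "inner (sgn \<omega>) (fst v) = a * x1 s" by blast
    \<comment> \<open>the differential rescales the part orthogonal to the direction by x / norm \<omega> and discards the part along it\<close>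
    define h where "h = (a, (norm \<omega> / x s) *\<^sub>R fst v)"
    have "v = (x s *\<^sub>R ((snd h - inner (sgn \<omega>) (snd h) *\<^sub>R sgn \<omega>) /\<^sub>R norm \<omega>) + (fst h * x1 s) *\<^sub>R sgn \<omega>,
            fst h * t1 s)"
      using a pos[OF assms(1)] assms(2) by (simp add: h_def prod_eq_iff scaleR_diff_right)
    then show "v \<in> tangent_space I x t (s, \<omega>)"
      unfolding tangent_space_def using immersion_derivative[OF assms] by blast
  }
qed

context
  fixes s :: real and \<omega> u :: "complex^'n" and p :: "'n heis"
  assumes s: "s \<in> I" and \<omega>: "\<omega> \<noteq> 0"
  defines "u \<equiv> sgn \<omega>" and "p \<equiv> immersion x t (s, \<omega>)"
begin

lemma norm_direction: "norm u = 1"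
  unfolding u_def using \<omega> by (simp add: norm_sgn)

lemma herm_direction: "herm u u = 1"
  by (simp add: herm_self norm_direction)

lemma herm_point: "herm (fst p) v = x s *\<^sub>R herm u v"
  by (simp add: p_def u_def immersion_def herm_scaleR_left)

text \<open>Let \<open>h\<close> be the Hermitian product of the direction with the horizontal part of \<open>v\<close>. Tangency
  prescribes \<open>Re h = a x'\<close> and the \<open>t\<close>-component \<open>a t'\<close>; the contact condition makes the latter
  \<open>- x Im h\<close>. Together these say \<open>h = a (x' - i t' / x)\<close>.\<close>

lemma contact_tangent_iff:
  "v \<in> contact_tangent I x t (s, \<omega>) \<longleftrightarrow> contact_form p v = 0 \<and> (\<exists>a. herm u (fst v) = a *\<^sub>R velocity s)"
proof -
  have "snd v = a * t1 s \<and> inner u (fst v) = a * x1 s \<longleftrightarrow> herm u (fst v) = a *\<^sub>R velocity s"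
    if "contact_form p v = 0" for a
  proof -
    have "snd v = - x s * Im (herm u (fst v))"
      using that by (simp add: contact_form_eq herm_point)
    then have "snd v = a * t1 s \<longleftrightarrow> Im (herm u (fst v)) = a * (- t1 s / x s)"
      using pos[OF s] by (simp add: field_simps) linarith
    then show ?thesis
      by (auto simp: inner_eq_Re_herm velocity_def complex_eq_iff)
  qed
  then show ?thesis
    unfolding contact_tangent_def tangent_space_eq[OF s \<omega>] contact_bundle_def p_def[symmetric] u_def[symmetric]
    by auto
qed

text \<open>For a vector in both spaces the Hermitian product lies in \<open>\<real> c \<inter> i \<real> c = {0}\<close>.\<close>

lemma xi'_iff: "v \<in> xi' I x t (s, \<omega>) \<longleftrightarrow> contact_form p v = 0 \<and> herm u (fst v) = 0"
proof
  assume "v \<in> xi' I x t (s, \<omega>)"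
  then obtain v0 where "v \<in> contact_tangent I x t (s, \<omega>)" "v0 \<in> contact_tangent I x t (s, \<omega>)"
    and v: "v = J p v0"
    unfolding xi'_def p_def by blast
  then obtain a b where a: "contact_form p v = 0" "herm u (fst v) = a *\<^sub>R velocity s"
    and b: "herm u (fst v0) = b *\<^sub>R velocity s"
    unfolding contact_tangent_iff by blast
  have ab: "contact_form p v = 0" "herm u (fst v) = a *\<^sub>R velocity s"
    "herm u (fst v) = \<i> * (b *\<^sub>R velocity s)"
    using a b by (simp_all add: v J_eq fst_of_coeffs herm_scale_right)
  then have "(complex_of_real a - \<i> * complex_of_real b) * velocity s = 0"
    by (simp add: scaleR_conv_of_real algebra_simps)
  then have "complex_of_real a - \<i> * complex_of_real b = 0"
    using velocity_nonzero[OF s] by (metis mult_eq_0_iff)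
  then have "a = 0"
    by (simp add: complex_eq_iff)
  then show "contact_form p v = 0 \<and> herm u (fst v) = 0" using ab by simp
next
  assume v: "contact_form p v = 0 \<and> herm u (fst v) = 0"
  define v0 where "v0 = of_coeffs p (- \<i> *s fst v, 0)"
  have "J p v0 = v"
    using v by (simp add: J_eq v0_def fst_of_coeffs vector_smult_assoc contact_vector_eq_iff[THEN iffD2, symmetric])
  moreover have "v \<in> contact_tangent I x t (s, \<omega>)" "v0 \<in> contact_tangent I x t (s, \<omega>)"
    using v by (auto simp: contact_tangent_iff v0_def fst_of_coeffs herm_scale_right herm_minus_right intro!: exI[of _ 0])
  ultimately show "v \<in> xi' I x t (s, \<omega>)"
    unfolding xi'_def p_def by blast
qed

text \<open>Passing through the point forces \<open>e\<^sup>i\<^sup>\<phi> A e = u\<close> at \<open>s\<close>, with \<open>e\<close> the \<open>m\<close>-th basis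
  vector. The direction of the curve is hence independent of the choice of \<open>\<phi>\<close> and \<open>A\<close>, which is
  what makes the orientation of \<open>e_n\<close> well defined.\<close>

lemma rotated_curve_derivative:
  assumes "horizontal_angle I x t \<phi>" "rot A (horizontal_curve m x t \<phi> s) = p"
  shows "fst (vector_derivative (\<lambda>\<sigma>. rot A (horizontal_curve m x t \<phi> \<sigma>)) (at s within I)) = velocity s *s u"
proof -
  have \<phi>: "(\<phi> has_real_derivative - t1 s / (x s)\<^sup>2) (at s within I)"
    using assms(1) s vector_derivatives[OF s] unfolding horizontal_angle_def by auto
  have z: "horizontal_curve m x t \<phi> s = (x s *\<^sub>R (cis (\<phi> s) *s axis m 1), t s)"
    by (auto simp: horizontal_curve_def vec_eq_iff axis_def complex_eq_iff)
  have "x s *\<^sub>R (cis (\<phi> s) *s (A *v axis m 1)) = x s *\<^sub>R u"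
    using assms(2) unfolding z p_def u_def immersion_def rot_def
    by (simp add: scaleR_eq_scale vector_scalar_commute)
  then have "cis (\<phi> s) *s (A *v axis m 1) = u"
    using pos[OF s] by simp
  then show ?thesis
    using vector_derivative_on_interval[OF interval nontrivial s
        has_vector_derivative_rot_horizontal_curve[OF dx[OF s] dt[OF s] \<phi> pos[OF s], of A m]]
    by (simp add: velocity_def)
qed

lemma ex_rotated_curve:
  obtains A where "unitary A" "rot A (horizontal_curve m x t \<theta> s) = p"
proof -
  have "norm (cis (- \<theta> s) *s u) = 1"
    by (simp add: norm_scale norm_direction)
  then obtain A where A: "unitary A" "A *v axis m 1 = cis (- \<theta> s) *s u"
    by (rule unitary_transitive)
  have z: "horizontal_curve m x t \<theta> s = (x s *\<^sub>R (cis (\<theta> s) *s axis m 1), t s)"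
    by (auto simp: horizontal_curve_def vec_eq_iff axis_def complex_eq_iff)
  have "rot A (horizontal_curve m x t \<theta> s) = p"
    unfolding z p_def immersion_def rot_def u_def[symmetric]
    by (simp add: scaleR_eq_scale vector_scalar_commute A vector_smult_assoc cis_mult u_def)
  then show ?thesis using that A by blast
qed

text \<open>Orthogonality to the Hermitian complement of \<open>u\<close> leaves the real multiples \<open>a c u\<close>; unit
  length gives \<open>a = 1\<close> or \<open>a = -1\<close>, and the orientation picks \<open>a = 1\<close>.\<close>

lemma e_n_eq: "e_n I m x t (s, \<omega>) = of_coeffs p (velocity s *s u, 0)"
proof -
  let ?P = "\<lambda>e. e \<in> contact_tangent I x t (s, \<omega>) \<and> levi p e e = 1 \<and> (\<forall>v\<in>xi' I x t (s, \<omega>). levi p e v = 0) \<and>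
       (\<exists>\<theta> A. horizontal_angle I x t \<theta> \<and> unitary A \<and> rot A (horizontal_curve m x t \<theta> s) = p \<and>
          levi p e (vector_derivative (\<lambda>\<sigma>. rot A (horizontal_curve m x t \<theta> \<sigma>)) (at s within I)) > 0)"
  have inner_scaled: "inner (c *s u) v = Re (cnj c * herm u v)" for c v
    by (simp add: inner_eq_Re_herm herm_scale_left)
  have unit: "cnj (velocity s) * velocity s = 1"
    using norm_velocity[OF s] by (metis complex_norm_square mult.commute of_real_1 power_one)
  have "(THE e. ?P e) = of_coeffs p (velocity s *s u, 0)"
  proof (rule the_equality)
    obtain A where A: "unitary A" "rot A (horizontal_curve m x t \<theta> s) = p"
      by (rule ex_rotated_curve)
    show "?P (of_coeffs p (velocity s *s u, 0))"
    proof (intro conjI)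
      show "\<exists>\<theta> A. horizontal_angle I x t \<theta> \<and> unitary A \<and> rot A (horizontal_curve m x t \<theta> s) = p \<and>
          levi p (of_coeffs p (velocity s *s u, 0))
            (vector_derivative (\<lambda>\<sigma>. rot A (horizontal_curve m x t \<theta> \<sigma>)) (at s within I)) > 0"
        using angle A by (intro exI[of _ \<theta>] exI[of _ A])
          (simp add: levi_eq fst_of_coeffs rotated_curve_derivative[OF angle A(2)] inner_scaled herm_scale_right
            herm_direction unit)
      have "herm u (fst (of_coeffs p (velocity s *s u, 0))) = 1 *\<^sub>R velocity s"
        by (simp add: fst_of_coeffs herm_scale_right herm_direction)
      then show "of_coeffs p (velocity s *s u, 0) \<in> contact_tangent I x t (s, \<omega>)"
        unfolding contact_tangent_iff by (metis contact_form_of_coeffs snd_conv)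
      show "levi p (of_coeffs p (velocity s *s u, 0)) (of_coeffs p (velocity s *s u, 0)) = 1"
        by (simp add: levi_eq fst_of_coeffs inner_scaled herm_scale_right herm_direction unit)
      show "\<forall>v\<in>xi' I x t (s, \<omega>). levi p (of_coeffs p (velocity s *s u, 0)) v = 0"
        by (simp add: xi'_iff levi_eq fst_of_coeffs inner_scaled)
    qed
  next
    fix e assume e: "?P e"
    then obtain a where a: "contact_form p e = 0" "herm u (fst e) = a *\<^sub>R velocity s"
      unfolding contact_tangent_iff by blast
    \<comment> \<open>the component of e in the Hermitian complement of the direction, to be shown zero\<close>
    define w where "w = fst e - (a *\<^sub>R velocity s) *s u"
    have w: "herm u w = 0"
      using a by (simp add: w_def herm_diff_right herm_scale_right herm_direction)
    have "of_coeffs p (w, 0) \<in> xi' I x t (s, \<omega>)"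
      using w by (simp add: xi'_iff fst_of_coeffs)
    then have "inner (fst e) w = 0"
      using e by (force simp: levi_eq fst_of_coeffs)
    moreover have "inner ((a *\<^sub>R velocity s) *s u) w = 0"
      by (simp add: inner_scaled w)
    ultimately have "inner w w = 0"
      by (metis w_def diff_zero inner_diff_left)
    then have fst_e: "fst e = (a *\<^sub>R velocity s) *s u"
      by (simp add: w_def)
    have "cnj (a *\<^sub>R velocity s) * (a *\<^sub>R velocity s) = complex_of_real (a * a)"
      using unit by (simp add: scaleR_conv_of_real mult_ac)
    then have "levi p e e = a * a"
      unfolding levi_eq fst_e inner_scaled herm_scale_right herm_direction by simp
    then have "a * a = 1" using e by simp
    moreover have "0 < a"
    proof -
      obtain \<phi> A where "horizontal_angle I x t \<phi>" "rot A (horizontal_curve m x t \<phi> s) = p"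
        "levi p e (vector_derivative (\<lambda>\<sigma>. rot A (horizontal_curve m x t \<phi> \<sigma>)) (at s within I)) > 0"
        using e by blast
      then have "0 < Re (cnj (a *\<^sub>R velocity s) * velocity s)"
        by (simp add: levi_eq rotated_curve_derivative fst_e inner_scaled herm_scale_right herm_direction)
      also have "cnj (a *\<^sub>R velocity s) * velocity s = complex_of_real a"
        using unit by (simp add: scaleR_conv_of_real)
      finally show ?thesis by simp
    qed
    ultimately have "a = 1"
      by (simp add: square_eq_1_iff)
    then show "e = of_coeffs p (velocity s *s u, 0)"
      using fst_e contact_vector_eq_iff[OF a(1)] by simp
  qed
  then show ?thesis
    unfolding e_n_def Let_def p_def by simp
qed

lemma e_2n_eq: "e_2n I m x t (s, \<omega>) = of_coeffs p ((\<i> * velocity s) *s u, 0)"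
  unfolding e_2n_def e_n_eq by (simp add: J_eq fst_of_coeffs vector_smult_assoc p_def)

text \<open>Tangency of \<open>b e_2n + T\<close> requires some \<open>a\<close> with \<open>1 - b x x' = a t'\<close> and \<open>b t' / x = a x'\<close>.
  Elimination of \<open>a\<close> by means of \<open>x'\<^sup>2 + (t' / x)\<^sup>2 = 1\<close>, without dividing by \<open>x'\<close> or \<open>t'\<close>, gives
  \<open>b x = x'\<close>.\<close>

lemma alpha_eq: "alpha I m x t (s, \<omega>) = x1 s / x s"
proof -
  have i_velocity: "\<i> * velocity s = Complex (t1 s / x s) (x1 s)"
    by (simp add: velocity_def complex_eq_iff)
  have "b *\<^sub>R e_2n I m x t (s, \<omega>) + reeb \<in> tangent_space I x t (s, \<omega>) \<longleftrightarrow> b = x1 s / x s" for b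
  proof -
    have "snd (b *\<^sub>R e_2n I m x t (s, \<omega>) + reeb) = 1 - b * (x s * x1 s)"
      by (simp add: e_2n_eq reeb_def of_coeffs_eq herm_point herm_scale_right herm_direction i_velocity)
    moreover have "inner (sgn \<omega>) (fst (b *\<^sub>R e_2n I m x t (s, \<omega>) + reeb)) = b * (t1 s / x s)"
      by (simp add: e_2n_eq reeb_def fst_of_coeffs inner_eq_Re_herm herm_scaleR_right herm_scale_right
          u_def[symmetric] herm_direction i_velocity)
    ultimately have "b *\<^sub>R e_2n I m x t (s, \<omega>) + reeb \<in> tangent_space I x t (s, \<omega>) \<longleftrightarrow>
        (\<exists>a. 1 - b * (x s * x1 s) = a * t1 s \<and> b * (t1 s / x s) = a * x1 s)"
      unfolding tangent_space_eq[OF s \<omega>] mem_Collect_eq by simp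
    also have "\<dots> \<longleftrightarrow> b = x1 s / x s"
    proof
      define \<tau> where "\<tau> = t1 s / x s"
      have t1: "t1 s = x s * \<tau>" and unit: "x1 s * x1 s + \<tau> * \<tau> = 1"
        using pos[OF s] unit_speed[OF s] by (simp_all add: \<tau>_def power2_eq_square)
      {
        assume "\<exists>a. 1 - b * (x s * x1 s) = a * t1 s \<and> b * (t1 s / x s) = a * x1 s"
        then obtain a where a: "1 - b * (x s * x1 s) = a * (x s * \<tau>)" "b * \<tau> = a * x1 s"
          unfolding t1 using pos[OF s] by auto
        have "b * x s = b * x s * (x1 s * x1 s + \<tau> * \<tau>)" by (simp add: unit)
        also have "\<dots> = x1 s * (b * (x s * x1 s)) + (b * \<tau>) * (x s * \<tau>)" by (simp add: algebra_simps)
        also have "\<dots> = x1 s * (b * (x s * x1 s) + a * (x s * \<tau>))" unfolding a(2) by (simp add: algebra_simps)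
        also have "\<dots> = x1 s" unfolding a(1)[symmetric] by simp
        finally show "b = x1 s / x s" using pos[OF s] by (simp add: field_simps)
      next
        assume b: "b = x1 s / x s"
        have "1 - b * (x s * x1 s) = \<tau> / x s * t1 s" "b * (t1 s / x s) = \<tau> / x s * x1 s"
          using unit pos[OF s] by (simp_all add: b t1)
        then show "\<exists>a. 1 - b * (x s * x1 s) = a * t1 s \<and> b * (t1 s / x s) = a * x1 s" by blast
      }
    qed
    finally show ?thesis .
  qed
  then show ?thesis unfolding alpha_def by simp
qed

end

text \<open>A parameter direction mapped into \<open>xi'\<close> has no \<open>s\<close>-component, as \<open>x'\<close> and \<open>t'\<close> do not vanish
  together. Only the direction \<open>u\<close> of \<open>i c u\<close> varies, at the rate \<open>v / x\<close>.\<close>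

lemma nabla_e_2n_iff:
  assumes s: "s \<in> I" and \<omega>: "\<omega> \<noteq> (0 :: complex^'n)" and v: "v \<in> xi' I x t (s, \<omega>)"
  shows "has_nabla I x t (e_2n I m x t) (s, \<omega>) v w \<longleftrightarrow>
    w = of_coeffs (immersion x t (s, \<omega>)) ((\<i> * velocity s / x s) *s fst v, 0)"
proof -
  let ?proj = "\<lambda>\<eta>. (\<eta> - inner (sgn \<omega>) \<eta> *\<^sub>R sgn \<omega>) /\<^sub>R norm \<omega>"
  let ?D = "\<lambda>h. (x s *\<^sub>R ?proj (snd h) + (fst h * x1 s) *\<^sub>R sgn \<omega>, fst h * t1 s)"
  define c' where "c' = \<i> * Complex (x2 s) ((t1 s * x1 s - t2 s * x s) / (x s)\<^sup>2)"
  define E where "E h = ((\<i> * velocity s) *s ?proj (snd h) + (fst h *\<^sub>R c') *s sgn \<omega>, 0::real)" for h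
  have herm_v: "contact_form (immersion x t (s, \<omega>)) v = 0" "herm (sgn \<omega>) (fst v) = 0"
    using v xi'_iff[OF s \<omega>] by blast+
  have "snd v = 0"
    using herm_v by (simp add: contact_form_eq immersion_def herm_scaleR_left)
  have field: "coeffs (immersion x t r) (e_2n I m x t r) = ((\<i> * velocity (fst r)) *s sgn (snd r), 0)"
    if "r \<in> param_domain I" for r
    using that by (cases r) (auto simp: param_domain_def e_2n_eq coeffs_of_coeffs)
  have "((\<lambda>\<sigma>. \<i> * velocity \<sigma>) has_vector_derivative c') (at s within I)"
    unfolding c'_def by (intro has_vector_derivative_mult_right velocity_derivative s)
  from has_derivative_Pair[OF has_derivative_direction_field[OF this \<omega>] has_derivative_const[of "0::real"]]
  have "((\<lambda>r. ((\<i> * velocity (fst r)) *s sgn (snd r), 0)) has_derivative E) (at (s, \<omega>) within param_domain I)"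
    unfolding E_def[abs_def] by simp
  then have E: "((\<lambda>r. coeffs (immersion x t r) (e_2n I m x t r)) has_derivative E) (at (s, \<omega>) within param_domain I)"
    by (rule has_derivative_transform[rotated 2]) (use s \<omega> in \<open>auto simp: field param_domain_def\<close>)
  have key: "E h = ((\<i> * velocity s / x s) *s fst v, 0)" if h: "?D h = v" for h
  proof -
    have "fst h * t1 s = 0" using h \<open>snd v = 0\<close> by auto
    moreover have "fst h * x1 s = 0"
    proof -
      have "inner (sgn \<omega>) (sgn \<omega>) = 1" using \<omega> by (metis norm_eq_1 norm_sgn)
      then have "inner (sgn \<omega>) (fst (?D h)) = fst h * x1 s"
        by (simp add: inner_add_right inner_diff_right)
      then have "inner (sgn \<omega>) (fst v) = fst h * x1 s" unfolding h .
      then show ?thesis using herm_v by (simp add: inner_eq_Re_herm)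
    qed
    ultimately have "fst h = 0" using unit_speed[OF s] by auto
    then have "fst v = complex_of_real (x s) *s ?proj (snd h)"
      using h by (auto simp: scaleR_eq_scale[symmetric])
    then show ?thesis
      using \<open>fst h = 0\<close> pos[OF s] by (simp add: E_def vector_smult_assoc)
  qed
  have "v \<in> tangent_space I x t (s, \<omega>)"
    using v unfolding xi'_def contact_tangent_def by blast
  then obtain D h where "(immersion x t has_derivative D) (at (s, \<omega>) within param_domain I)" "D h = v"
    unfolding tangent_space_def by blast
  then have h: "?D h = v" using immersion_derivative_unique[OF s \<omega>] by simp
  show ?thesis
  proof
    assume "has_nabla I x t (e_2n I m x t) (s, \<omega>) v w"
    then obtain D' E' h' where *: "(immersion x t has_derivative D') (at (s, \<omega>) within param_domain I)" "D' h' = v"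
      "((\<lambda>r. coeffs (immersion x t r) (e_2n I m x t r)) has_derivative E') (at (s, \<omega>) within param_domain I)"
      "w = of_coeffs (immersion x t (s, \<omega>)) (E' h')"
      unfolding has_nabla_def by blast
    have "E' = E" by (rule derivative_param_domain_unique[OF interval nontrivial s \<omega> *(3) E])
    moreover have "?D h' = v" using immersion_derivative_unique[OF s \<omega> *(1)] *(2) by simp
    ultimately show "w = of_coeffs (immersion x t (s, \<omega>)) ((\<i> * velocity s / x s) *s fst v, 0)"
      using *(4) key by simp
  next
    assume "w = of_coeffs (immersion x t (s, \<omega>)) ((\<i> * velocity s / x s) *s fst v, 0)"
    then have "w = of_coeffs (immersion x t (s, \<omega>)) (E h)"
      unfolding key[OF h] .
    then show "has_nabla I x t (e_2n I m x t) (s, \<omega>) v w"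
      unfolding has_nabla_def
      by (intro exI conjI) (rule immersion_derivative[OF s \<omega>], rule h, rule E)
  qed
qed

text \<open>For at least two dimensions, the terms \<open>- i c / x\<close> and \<open>i x' / x\<close> add up to the real number \<open>- t' / x\<^sup>2\<close>, and a
  nonzero vector of \<open>xi'\<close> shows that this eigenvalue is unique. In one complex dimension \<open>xi'\<close> is trivial, and the
  defining formula simplifies since its square root equals \<open>x\<close>.\<close>

lemma k_inv_eq:
  assumes s: "s \<in> I" and \<omega>: "\<omega> \<noteq> (0 :: complex^'n)"
  shows "k_inv I m x t (s, \<omega>) = - t1 s / (x s)\<^sup>2"
proof (cases "CARD('n) \<ge> 2")
  case True
  let ?p = "immersion x t (s, \<omega>)"
  let ?k = "- t1 s / (x s)\<^sup>2"
  have nabla: "(\<exists>w. has_nabla I x t (e_2n I m x t) (s, \<omega>) v w \<and> - w + alpha I m x t (s, \<omega>) *\<^sub>R J ?p v = \<kappa> *\<^sub>R v)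
      \<longleftrightarrow> ?k *\<^sub>R v = \<kappa> *\<^sub>R v" if v: "v \<in> xi' I x t (s, \<omega>)" for v \<kappa>
  proof -
    have "- of_coeffs ?p ((\<i> * velocity s / x s) *s fst v, 0) + (x1 s / x s) *\<^sub>R J ?p v = ?k *\<^sub>R v" (is "?w = _")
    proof (rule prod_eqI)
      have "complex_of_real (x1 s / x s) * \<i> - \<i> * velocity s / x s = complex_of_real ?k"
        using pos[OF s] by (simp add: velocity_def complex_eq_iff power2_eq_square)
      then show "fst ?w = fst (?k *\<^sub>R v)"
        by (simp only: fst_add fst_uminus fst_scaleR J_eq fst_of_coeffs fst_conv scale_combination)
           (simp only: scaleR_eq_scale)
      have "contact_form ?p v = 0" "herm (sgn \<omega>) (fst v) = 0"
        using v xi'_iff[OF s \<omega>] by blast+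
      then show "snd ?w = snd (?k *\<^sub>R v)"
        by (simp add: J_eq of_coeffs_eq contact_form_eq immersion_def herm_scaleR_left herm_scale_right)
    qed
    then show ?thesis
      unfolding nabla_e_2n_iff[OF s \<omega> v] alpha_eq[OF s \<omega>] by simp
  qed
  have "(\<forall>v\<in>xi' I x t (s, \<omega>). ?k *\<^sub>R v = \<kappa> *\<^sub>R v) \<longleftrightarrow> \<kappa> = ?k" for \<kappa>
  proof
    obtain w :: "complex^'n" where w: "w \<noteq> 0" "herm (sgn \<omega>) w = 0"
      using ex_herm_orthogonal[OF True] by blast
    assume "\<forall>v\<in>xi' I x t (s, \<omega>). ?k *\<^sub>R v = \<kappa> *\<^sub>R v"
    moreover have "of_coeffs ?p (w, 0) \<in> xi' I x t (s, \<omega>)"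
      using w by (simp add: xi'_iff[OF s \<omega>] fst_of_coeffs)
    ultimately have "?k *\<^sub>R w = \<kappa> *\<^sub>R w"
      by (metis fst_conv fst_of_coeffs fst_scaleR)
    then show "\<kappa> = ?k" using w(1) by (metis scaleR_cancel_right)
  qed simp
  then have "(THE \<kappa>. \<forall>v\<in>xi' I x t (s, \<omega>). ?k *\<^sub>R v = \<kappa> *\<^sub>R v) = ?k"
    by simp
  then show ?thesis
    using True nabla by (simp add: k_inv_def cong: ball_cong)
next
  case False
  have "(x s * x1 s)\<^sup>2 + (t1 s)\<^sup>2 = (x s)\<^sup>2 * ((x1 s)\<^sup>2 + (t1 s / x s)\<^sup>2)"
    using pos[OF s] by (simp add: power_mult_distrib power_divide distrib_left)
  then have "sqrt ((x s * x1 s)\<^sup>2 + (t1 s)\<^sup>2) = x s"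
    using pos[OF s] unit_speed[OF s] by simp
  then show ?thesis
    using False by (simp add: k_inv_def Let_def vector_derivatives[OF s] power2_eq_square)
qed

end

section \<open>Existence and uniqueness\<close>

lemma horizontal_speed:
  fixes m :: "'n::finite"
  assumes "is_interval I" "interior I \<noteq> {}" "s \<in> I" "horizontal_angle I x t \<theta>"
    and x: "(x has_real_derivative x') (at s within I)"
    and t: "(t has_real_derivative t') (at s within I)"
    and pos: "0 < x s"
  defines "v \<equiv> vector_derivative (horizontal_curve m x t \<theta>) (at s within I)"
  shows "sqrt (levi p v v) = sqrt (x'\<^sup>2 + (t' / x s)\<^sup>2)"
proof -
  have "vector_derivative t (at s within I) = t'"
    using vector_derivative_on_interval[OF assms(1-3) t[unfolded has_real_derivative_iff_has_vector_derivative]] .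
  then have \<theta>: "(\<theta> has_real_derivative - t' / (x s)\<^sup>2) (at s within I)"
    using assms(3,4) unfolding horizontal_angle_def by blast
  have "rot (mat 1) p = p" for p :: "'n heis"
    by (simp add: rot_def)
  then have "fst v = Complex x' (- t' / x s) *s (cis (\<theta> s) *s axis m 1)"
    unfolding v_def
    using vector_derivative_on_interval[OF assms(1-3)
        has_vector_derivative_rot_horizontal_curve[OF x t \<theta> pos, of "mat 1" m]]
    by simp
  then have "norm (fst v) = cmod (Complex x' (- t' / x s))"
    by (simp add: norm_scale norm_mult)
  then show ?thesis
    by (simp add: levi_eq norm_eq_sqrt_inner[symmetric] cmod_def power_divide)
qed

text \<open>The analytic content of \<open>realizes\<close>. Second derivatives enter because \<open>e_2n\<close> is built from
  \<open>x'\<close> and \<open>t'\<close> and is itself differentiated in the definition of \<open>k_inv\<close>.\<close>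

lemma realizesE:
  assumes "is_interval I" "interior I \<noteq> {}" "realizes I m a k x t (S :: 'n::finite heis set)"
  obtains x1 t1 where
    "\<And>s. s \<in> I \<Longrightarrow> (t has_real_derivative t1 s) (at s within I)"
    "\<And>s. s \<in> I \<Longrightarrow> 0 < x s"
    "\<And>s. s \<in> I \<Longrightarrow> (x1 s)\<^sup>2 + (t1 s / x s)\<^sup>2 = 1"
    "\<And>s. s \<in> I \<Longrightarrow> a s = x1 s / x s"
    "\<And>s. s \<in> I \<Longrightarrow> k s = - t1 s / (x s)\<^sup>2"
    "S = {(z, \<tau>). \<exists>s\<in>I. (norm z, \<tau>) = (x s, t s)}"
proof -
  have curve: "generating_curve I x t" and S: "S = {(z, \<tau>). \<exists>s\<in>I. (norm z, \<tau>) = (x s, t s)}"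
    and speed: "horizontal_arclength I m x t"
    and inv: "\<And>s \<omega>. s \<in> I \<Longrightarrow> \<omega> \<noteq> 0 \<Longrightarrow> alpha I m x t (s, \<omega>) = a s \<and> k_inv I m x t (s, \<omega>) = k s"
    using assms(3) unfolding realizes_def rot_sym_hypersurface_def by blast+
  have smooth: "smooth_on I x" "smooth_on I t" and pos: "\<And>s. s \<in> I \<Longrightarrow> 0 < x s"
    using curve unfolding generating_curve_def by blast+
  obtain x1 where x1: "smooth_on I x1" "\<forall>s\<in>I. (x has_real_derivative x1 s) (at s within I)"
    by (rule smooth_on_derivE[OF smooth(1)])
  obtain x2 where x2: "\<forall>s\<in>I. (x1 has_real_derivative x2 s) (at s within I)"
    by (rule smooth_on_derivE[OF x1(1)])
  obtain t1 where t1: "smooth_on I t1" "\<forall>s\<in>I. (t has_real_derivative t1 s) (at s within I)"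
    by (rule smooth_on_derivE[OF smooth(2)])
  obtain t2 where t2: "\<forall>s\<in>I. (t1 has_real_derivative t2 s) (at s within I)"
    by (rule smooth_on_derivE[OF t1(1)])
  obtain \<theta> where \<theta>: "horizontal_angle I x t \<theta>"
    "\<And>s. s \<in> I \<Longrightarrow> sqrt (levi (horizontal_curve m x t \<theta> s)
       (vector_derivative (horizontal_curve m x t \<theta>) (at s within I))
       (vector_derivative (horizontal_curve m x t \<theta>) (at s within I))) = 1"
    using speed unfolding horizontal_arclength_def Let_def by blast
  have unit: "(x1 s)\<^sup>2 + (t1 s / x s)\<^sup>2 = 1" if "s \<in> I" for s
    using \<theta>(2)[OF that] unfolding horizontal_speed[OF assms(1,2) that \<theta>(1) bspec[OF x1(2) that] bspec[OF t1(2) that] pos[OF that]]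
    by simp
  interpret unit_speed_profile I m x x1 x2 t t1 t2 \<theta>
    by unfold_locales (use assms(1,2) x1(2) x2 t1(2) t2 pos \<theta>(1) unit in auto)
  have "a s = x1 s / x s" "k s = - t1 s / (x s)\<^sup>2" if "s \<in> I" for s
  proof -
    have "axis m 1 \<noteq> (0 :: complex^'n)" by (simp add: axis_eq_0_iff)
    then show "a s = x1 s / x s" "k s = - t1 s / (x s)\<^sup>2"
      using inv[OF that] alpha_eq[OF that] k_inv_eq[OF that] by metis+
  qed
  then show ?thesis
    using that[of t1 x1] bspec[OF t1(2)] pos unit S by blast
qed

lemma realizes_exp_antiderivative:
  assumes I: "is_interval I" "interior I \<noteq> {}"
    and a: "smooth_on I a" "\<And>s. s \<in> I \<Longrightarrow> (A has_real_derivative a s) (at s within I)"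
    and k: "smooth_on I k" "\<And>s. s \<in> I \<Longrightarrow> (a s)\<^sup>2 + (k s)\<^sup>2 = 1 / (exp (A s))\<^sup>2"
  shows "\<exists>t. \<exists>S :: 'n::finite heis set. realizes I m a k (\<lambda>s. exp (A s)) t S"
proof -
  define x where "x s = exp (A s)" for s
  define x1 where "x1 s = a s * x s" for s
  \<comment> \<open>t1 is written as a product of smooth factors\<close>
  define t1 where "t1 s = (-1 * k s) * (x s * x s)" for s
  have x: "smooth_on I x"
    using smooth_on_exp_antiderivative[OF a] by (simp add: x_def[abs_def])
  have x_pos: "0 < x s" for s
    by (simp add: x_def)
  have dx: "(x has_real_derivative x1 s) (at s within I)" if "s \<in> I" for s
    unfolding x_def[abs_def] x1_def using a(2)[OF that] by (auto intro!: derivative_eq_intros)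
  have "smooth_on I x1"
    unfolding x1_def[abs_def] by (intro smooth_on_mult a(1) x)
  then obtain x2 where dx1: "\<forall>s\<in>I. (x1 has_real_derivative x2 s) (at s within I)"
    by (rule smooth_on_derivE)
  have t1: "smooth_on I t1"
    unfolding t1_def[abs_def] by (intro smooth_on_mult smooth_on_const x k(1))
  then obtain t2 where dt1: "\<forall>s\<in>I. (t1 has_real_derivative t2 s) (at s within I)"
    by (rule smooth_on_derivE)
  obtain t where dt: "\<And>s. s \<in> I \<Longrightarrow> (t has_real_derivative t1 s) (at s within I)"
    using antiderivative_on_interval[OF I(1) smooth_on_continuous[OF t1]] by blast
  obtain \<theta> where d\<theta>: "\<And>s. s \<in> I \<Longrightarrow> (\<theta> has_real_derivative k s) (at s within I)"
    using antiderivative_on_interval[OF I(1) smooth_on_continuous[OF k(1)]] by blast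
  have t1_k: "- t1 s / (x s)\<^sup>2 = k s" for s
    using x_pos[of s] by (simp add: t1_def power2_eq_square)
  have vd: "vector_derivative x (at s within I) = x1 s" "vector_derivative t (at s within I) = t1 s"
    if "s \<in> I" for s
    using vector_derivative_on_interval[OF I that] dx[OF that] dt[OF that]
    by (simp_all add: has_real_derivative_iff_has_vector_derivative)
  have angle: "horizontal_angle I x t \<theta>"
    unfolding horizontal_angle_def by (intro ballI) (simp only: vd t1_k d\<theta>)
  have unit: "(x1 s)\<^sup>2 + (t1 s / x s)\<^sup>2 = 1" if "s \<in> I" for s
  proof -
    have "t1 s / x s = - k s * x s" using x_pos[of s] by (simp add: t1_def)
    then have "(x1 s)\<^sup>2 + (t1 s / x s)\<^sup>2 = ((a s)\<^sup>2 + (k s)\<^sup>2) * (x s)\<^sup>2"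
      by (simp add: x1_def power_mult_distrib algebra_simps)
    then show ?thesis unfolding k(2)[OF that] by (simp add: x_def)
  qed
  interpret unit_speed_profile I m x x1 x2 t t1 t2 \<theta>
    by unfold_locales (use I dx dx1 dt dt1 x_pos angle unit in auto)
  define S :: "'n heis set" where "S = {(z, \<tau>). \<exists>s\<in>I. (norm z, \<tau>) = (x s, t s)}"
  have "(x1 s, t1 s) \<noteq> (0, 0)" if "s \<in> I" for s
    using unit[OF that] by auto
  then have "generating_curve I x t"
    unfolding generating_curve_def using x smooth_on_of_deriv[OF t1 dt] x_pos by (auto simp: vd)
  moreover have "rot U ` S = S" if "unitary U" for U
    unfolding S_def by (rule rot_image_of_norm_set[OF that])
  ultimately have "rot_sym_hypersurface I x t S"
    unfolding rot_sym_hypersurface_def S_def by blast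
  moreover have "horizontal_arclength I m x t"
    unfolding horizontal_arclength_def Let_def
    using angle by (intro exI[of _ \<theta>]) (simp add: horizontal_speed[OF I _ angle dx dt x_pos] unit)
  moreover have "alpha I m x t (s, \<omega>) = a s \<and> k_inv I m x t (s, \<omega>) = k s" if "s \<in> I" "\<omega> \<noteq> 0" for s \<omega>
    unfolding alpha_eq[OF that] k_inv_eq[OF that] t1_k using x_pos[of s] by (simp add: x1_def)
  ultimately have "realizes I m a k x t S"
    unfolding realizes_def by blast
  then show ?thesis unfolding x_def[abs_def] by blast
qed

text \<open>The arc-length condition divided by \<open>x\<^sup>2\<close> is \<open>a\<^sup>2 + k\<^sup>2 = 1 / x\<^sup>2\<close>: no constant of
  integration is left in the radius.\<close>

lemma realizes_radius:
  assumes "is_interval I" "interior I \<noteq> {}" "realizes I m a k x t S" "s \<in> I"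
  shows "x s = 1 / sqrt ((a s)\<^sup>2 + (k s)\<^sup>2)"
proof (rule realizesE[OF assms(1-3)])
  fix x1 t1
  assume pos: "\<And>s. s \<in> I \<Longrightarrow> 0 < x s"
    and unit: "\<And>s. s \<in> I \<Longrightarrow> (x1 s)\<^sup>2 + (t1 s / x s)\<^sup>2 = 1"
    and ak: "\<And>s. s \<in> I \<Longrightarrow> a s = x1 s / x s" "\<And>s. s \<in> I \<Longrightarrow> k s = - t1 s / (x s)\<^sup>2"
  have "(a s)\<^sup>2 + (k s)\<^sup>2 = ((x1 s)\<^sup>2 + (t1 s / x s)\<^sup>2) / (x s)\<^sup>2"
    using pos[OF assms(4)] by (simp add: ak[OF assms(4)] power2_eq_square add_divide_distrib)
  also have "\<dots> = (1 / x s)\<^sup>2"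
    unfolding unit[OF assms(4)] by (simp add: power_divide)
  finally have "(a s)\<^sup>2 + (k s)\<^sup>2 = (1 / x s)\<^sup>2" .
  then show ?thesis using pos[OF assms(4)] by simp
qed

lemma realizes_unique:
  fixes S1 S2 :: "'n::finite heis set"
  assumes I: "is_interval I" "interior I \<noteq> {}"
    and r1: "realizes I m a k x1 t1 S1" and r2: "realizes I m a k x2 t2 S2"
  shows "\<exists>\<Psi>\<in>PSH. \<Psi> ` S1 = S2"
proof -
  have x: "x1 s = x2 s" if "s \<in> I" for s
    using realizes_radius[OF I r1 that] realizes_radius[OF I r2 that] by simp
  obtain t1' where t1': "\<And>s. s \<in> I \<Longrightarrow> (t1 has_real_derivative t1' s) (at s within I)"
    "\<And>s. s \<in> I \<Longrightarrow> 0 < x1 s" "\<And>s. s \<in> I \<Longrightarrow> k s = - t1' s / (x1 s)\<^sup>2"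
    and S1: "S1 = {(z, \<tau>). \<exists>s\<in>I. (norm z, \<tau>) = (x1 s, t1 s)}"
    by (rule realizesE[OF I r1]) blast
  obtain t2' where t2': "\<And>s. s \<in> I \<Longrightarrow> (t2 has_real_derivative t2' s) (at s within I)"
    "\<And>s. s \<in> I \<Longrightarrow> k s = - t2' s / (x2 s)\<^sup>2"
    and S2: "S2 = {(z, \<tau>). \<exists>s\<in>I. (norm z, \<tau>) = (x2 s, t2 s)}"
    by (rule realizesE[OF I r2]) blast
  have "((\<lambda>s. t2 s - t1 s) has_real_derivative 0) (at s within I)" if "s \<in> I" for s
  proof -
    have "t2' s = t1' s"
      using t1'(2)[OF that] t1'(3)[OF that] t2'(2)[OF that] x[OF that] by simp
    then show ?thesis
      using DERIV_diff[OF t2'(1)[OF that] t1'(1)[OF that]] by simp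
  qed
  then obtain c where c: "\<And>s. s \<in> I \<Longrightarrow> t2 s - t1 s = c"
    using has_field_derivative_zero_constant[of I "\<lambda>s. t2 s - t1 s"] is_interval_convex[OF I(1)] by blast
  have t: "t2 s = c + t1 s" if "s \<in> I" for s
    using c[OF that] by simp
  have lift: "heis_mult (0, c) (z, \<tau>) = (z, c + \<tau>)" for z :: "complex^'n" and \<tau>
    by (simp add: heis_mult_def)
  have "heis_mult (0, c) ` S1 = S2"
  proof (intro equalityI subsetI)
    fix p assume "p \<in> heis_mult (0, c) ` S1"
    then show "p \<in> S2" unfolding S1 S2 using x t by (auto simp: lift)
  next
    fix p assume "p \<in> S2"
    then obtain z s where "s \<in> I" "norm z = x2 s" "p = (z, t2 s)" unfolding S2 by auto
    then have "p = heis_mult (0, c) (z, t1 s)" "(z, t1 s) \<in> S1"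
      unfolding S1 using x t by (auto simp: lift)
    then show "p \<in> heis_mult (0, c) ` S1" by blast
  qed
  then show ?thesis using PSH.translation by blast
qed

theorem theorem3p8:
  fixes I :: "real set" and a k A :: "real \<Rightarrow> real" and m :: "'n::finite"
  assumes "is_interval I" and "interior I \<noteq> {}"
    and "smooth_on I a"
    and "\<forall>s\<in>I. (A has_real_derivative a s) (at s within I)"
    and "\<forall>s\<in>I. 1 / (exp (A s))\<^sup>2 - (a s)\<^sup>2 \<ge> 0"
    and "smooth_on I k"
    and "\<forall>s\<in>I. (k s)\<^sup>2 = 1 / (exp (A s))\<^sup>2 - (a s)\<^sup>2"
  shows "(\<exists>x t. \<exists>S :: 'n heis set. realizes I m a k x t S) \<and>
    (\<forall>x1 t1 x2 t2. \<forall>S1 S2 :: 'n heis set.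
       realizes I m a k x1 t1 S1 \<and> realizes I m a k x2 t2 S2 \<longrightarrow> (\<exists>\<Psi>\<in>PSH. \<Psi> ` S1 = S2))"
proof (intro conjI allI impI)
  have "(a s)\<^sup>2 + (k s)\<^sup>2 = 1 / (exp (A s))\<^sup>2" if "s \<in> I" for s
    using assms(7) that by simp
  then have "\<exists>t. \<exists>S :: 'n heis set. realizes I m a k (\<lambda>s. exp (A s)) t S"
    using assms(4) by (intro realizes_exp_antiderivative assms(1-3,6)) auto
  then show "\<exists>x t. \<exists>S :: 'n heis set. realizes I m a k x t S"
    by (rule exI[where x = "\<lambda>s. exp (A s)"])
next
  fix x1 t1 x2 t2 and S1 S2 :: "'n heis set"
  assume "realizes I m a k x1 t1 S1 \<and> realizes I m a k x2 t2 S2"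
  then show "\<exists>\<Psi>\<in>PSH. \<Psi> ` S1 = S2"
    using realizes_unique[OF assms(1,2)] by blast
qed

end
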